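(* Let $H$ be an infinite dimensional separable Hilbert space and $I$ a countable index set. Let $w=\{w_j\}_{j\in I}$ be a frame sequence in $H$ with canonical dual $\widetilde w=\{\widetilde w_j\}_{j\in I}$, $f=\{f_i\}_{i\in I}$ a frame for $H$ and $u=\{u_i\}_{i\in I}$ a Parseval frame for $H$. Let $y=\{y_i\}_{i\in I}$ be given by $y_i:=\sum_{k\in I}\langle u_k,f_i\rangle\widetilde w_k$. Let (C) denote the condition $(G(\widetilde w,w)^t-\mathcal I)G(u,f)=\mathbf 0$, i.e. $\sum_{k\in I}\langle\widetilde w_k,w_j\rangle\langle u_k,f_i\rangle=\langle u_j,f_i\rangle$ for all $i,j\in I$. (i) If $y$ is a Parseval frame for $\overline{span}\{w_j\}$, (C) holds, and either $\dim((span\{w_j\})^\perp)<\dim(Ker(T_y))$ or $\dim((span\{w_j\})^\perp)=\dim(Ker(T_y))=\infty$, then there exists a Parseval frame $v=\{v_i\}_{i\in I}$ for $H$, which is not an orthonormal basis, such that $w$ is a weak R-dual of $f$ with respect to $u$ and $v$. (ii) If $y$ is a Parseval frame for $\overline{span}\{w_j\}$, (C) holds, and $\dim((span\{w_j\})^\perp)=\dim(Ker(T_y))<\infty$, then there exists an orthonormal basis $v=\{v_i\}_{i\in I}$ for $H$ such that $w$ is a weak R-dual of $f$ with respect to $u$ and $v$. Moreover, $w$ cannot be a weak R-dual of $f$ with respect to $u$ and any Parseval frame $v'$ which is not an orthonormal basis. (iii) If $\dim((span\{w_j\})^\perp)>\dim(Ker(T_y))$, then $w$ cannot be a weak R-dual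 of $f$ with respect to $u$ and any Parseval frame $v$.
   Context: Inner products are linear in the first variable. A sequence $\{f_i\}_{i\in I}$ in $H$ is a frame for $H$ if there are $0<A\le B<\infty$ with $A\|x\|^2\le\sum_{i}|\langle x,f_i\rangle|^2\le B\|x\|^2$ for all $x\in H$; it is a Parseval frame if one can take $A=B=1$. A sequence is a frame sequence if it is a frame for its closed linear span. The canonical dual of a frame sequence $w$ is $\widetilde w_j=S_w^{-1}w_j$, where $S_w g=\sum_j\langle g,w_j\rangle w_j$ is the frame operator of $w$ on $\overline{span}\{w_j\}$. $T_y:\ell^2(I)\to H$, $T_y(\{c_i\})=\sum_i c_iy_i$, is the synthesis operator of $y$. Dimensions are Hilbert space dimensions (finite or $\infty$; all spaces are separable). For sequences $g,h$ in $H$ indexed by $I$, $G(g,h)$ denotes the matrix $(\langle g_i,h_j\rangle)_{i,j\in I}$, $G(g,h)^t$ its transpose, and $\mathcal I$ the infinite identity matrix. Weak R-dual: let $u,v$ be Parseval frames for $H$ and $f$ a sequence in $H$ such that $\sum_{i\in I}|\langle f_i,u_j\rangle|^2<\infty$ for all $j\in I$ and $(G(v,v)^t-\mathcal I)G(f,u)=\mathbf 0$ (i.e. $\sum_{k}\langle v_k,v_i\rangle\langle f_k,u_j\rangle=\langle f_i,u_j\rangle$ for all $i,j$). Then the sequence $w=\{w_j\}_{j\in I}$ given by $w_j=\sum_{i\in I}\langle f_i,u_j\rangle v_i$ is called the weak R-dual of $f$ with respect to $u$ and $v$. (So "$w$ is a weak R-dual of $f$ with respect to $u$ and $v$" means that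 all these conditions hold.) *)

theory Defs
  imports "HOL-Analysis.Analysis" "HOL-Library.Extended_Nat"
begin

class complex_vector = real_vector +
  fixes scaleC :: "complex \<Rightarrow> 'a \<Rightarrow> 'a" (infixr \<open>*\<^sub>C\<close> 75)
  assumes scaleC_add_right: "a *\<^sub>C (x + y) = a *\<^sub>C x + a *\<^sub>C y"
    and scaleC_add_left: "(a + b) *\<^sub>C x = a *\<^sub>C x + b *\<^sub>C x"
    and scaleC_scaleC: "a *\<^sub>C b *\<^sub>C x = (a * b) *\<^sub>C x"
    and scaleC_one: "1 *\<^sub>C x = x"
    and scaleR_scaleC: "r *\<^sub>R x = complex_of_real r *\<^sub>C x"

global_interpretation complex_vector: vector_space "scaleC :: complex \<Rightarrow> 'a \<Rightarrow> 'a::complex_vector"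
  by unfold_locales
    (simp_all add: scaleC_add_right scaleC_add_left scaleC_scaleC scaleC_one)

abbreviation cspan :: "'a::complex_vector set \<Rightarrow> 'a set" where
  "cspan \<equiv> complex_vector.span"

text \<open>The inner product is linear in the first and conjugate linear in the second variable.
  Positive definiteness is contained in \<open>cinner_self\<close>.\<close>

class complex_inner = complex_vector + real_normed_vector +
  fixes cinner :: "'a \<Rightarrow> 'a \<Rightarrow> complex"
  assumes cinner_commute: "cinner x y = cnj (cinner y x)"
    and cinner_add_left: "cinner (x + y) z = cinner x z + cinner y z"
    and cinner_scaleC_left: "cinner (a *\<^sub>C x) y = a * cinner x y"
    and cinner_self: "cinner x x = complex_of_real ((norm x)\<^sup>2)"

class chilbert_space = complex_inner + complete_space

typedef 'i ell2 = "{c :: 'i \<Rightarrow> complex. (\<lambda>i. (cmod (c i))\<^sup>2) summable_on UNIV}"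
  morphisms ell2_coeff Abs_ell2
  by (intro exI[of _ "\<lambda>_. 0"]) simp

lemma ell2_coeff_summable: "(\<lambda>i. (cmod (ell2_coeff x i))\<^sup>2) summable_on UNIV"
  using ell2_coeff[of x] by simp

lemma ell2_eqI: "(\<And>i. ell2_coeff x i = ell2_coeff y i) \<Longrightarrow> x = y"
  by (metis ell2_coeff_inject ext)

definition ell2_norm :: "'i ell2 \<Rightarrow> real" where
  "ell2_norm x = sqrt (\<Sum>\<^sub>\<infinity>i. (cmod (ell2_coeff x i))\<^sup>2)"

lemma ell2_norm_finite:
  assumes "finite F" shows "L2_set (\<lambda>i. cmod (ell2_coeff x i)) F \<le> ell2_norm x"
  unfolding L2_set_def ell2_norm_def
  using finite_sum_le_infsum[OF ell2_coeff_summable assms] by simp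

lemma ell2_bounded:
  assumes "\<And>F. finite F \<Longrightarrow> L2_set (\<lambda>i. cmod (c i)) F \<le> B"
  shows "(\<lambda>i. (cmod (c i))\<^sup>2) summable_on UNIV"
    and "sqrt (\<Sum>\<^sub>\<infinity>i. (cmod (c i))\<^sup>2) \<le> B"
proof -
  have B: "0 \<le> B"
    using assms[of "{}"] by simp
  have *: "(\<Sum>i\<in>F. (cmod (c i))\<^sup>2) \<le> B\<^sup>2" if "finite F" for F
    using assms[OF that] unfolding L2_set_def by (simp add: real_sqrt_le_iff' B sum_nonneg sqrt_le_D)
  show s: "(\<lambda>i. (cmod (c i))\<^sup>2) summable_on UNIV"
    by (rule nonneg_bdd_above_summable_on) (use * in \<open>auto intro!: bdd_aboveI\<close>)
  have "(\<Sum>\<^sub>\<infinity>i. (cmod (c i))\<^sup>2) \<le> B\<^sup>2"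
    by (rule infsum_le_finite_sums[OF s]) (use * in auto)
  then show "sqrt (\<Sum>\<^sub>\<infinity>i. (cmod (c i))\<^sup>2) \<le> B"
    using B by (simp add: real_le_lsqrt)
qed

lemma ell2_L2_add:
  assumes "finite F"
  shows "L2_set (\<lambda>i. cmod (ell2_coeff x i + ell2_coeff y i)) F \<le> ell2_norm x + ell2_norm y"
proof -
  have "L2_set (\<lambda>i. cmod (ell2_coeff x i + ell2_coeff y i)) F
      \<le> L2_set (\<lambda>i. cmod (ell2_coeff x i) + cmod (ell2_coeff y i)) F"
    by (rule L2_set_mono) (auto simp: norm_triangle_ineq)
  also have "\<dots> \<le> L2_set (\<lambda>i. cmod (ell2_coeff x i)) F + L2_set (\<lambda>i. cmod (ell2_coeff y i)) F"
    by (rule L2_set_triangle_ineq)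
  also have "\<dots> \<le> ell2_norm x + ell2_norm y"
    by (intro add_mono ell2_norm_finite assms)
  finally show ?thesis .
qed

lemma ell2_scale_summable: "(\<lambda>i. (cmod (a * ell2_coeff x i))\<^sup>2) summable_on UNIV"
  unfolding norm_mult power_mult_distrib
  by (intro summable_on_cmult_right ell2_coeff_summable)

lemma ell2_cinner_summable: "(\<lambda>i. ell2_coeff x i * cnj (ell2_coeff y i)) summable_on UNIV"
proof (rule abs_summable_summable, rule summable_on_comparison_test)
  show "(\<lambda>i. (cmod (ell2_coeff x i))\<^sup>2 + (cmod (ell2_coeff y i))\<^sup>2) summable_on UNIV"
    by (intro summable_on_add ell2_coeff_summable)
  fix i
  have "a * b \<le> a\<^sup>2 + b\<^sup>2" if "0 \<le> a" "0 \<le> b" for a b :: real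
    using sum_squares_bound[of a b] that mult_nonneg_nonneg[OF that] by linarith
  then show "norm (ell2_coeff x i * cnj (ell2_coeff y i))
      \<le> (cmod (ell2_coeff x i))\<^sup>2 + (cmod (ell2_coeff y i))\<^sup>2"
    by (simp add: norm_mult)
qed simp

instantiation ell2 :: (type) complex_vector
begin

definition "zero_ell2 = Abs_ell2 (\<lambda>_. 0)"
definition "plus_ell2 x y = Abs_ell2 (\<lambda>i. ell2_coeff x i + ell2_coeff y i)"
definition "uminus_ell2 x = Abs_ell2 (\<lambda>i. - ell2_coeff x i)"
definition "minus_ell2 x y = x + - (y :: 'a ell2)"
definition "scaleC_ell2 a x = Abs_ell2 (\<lambda>i. a * ell2_coeff x i)"
definition "scaleR_ell2 r x = Abs_ell2 (\<lambda>i. complex_of_real r * ell2_coeff x i)"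

lemma coeff_zero: "ell2_coeff 0 i = 0"
  unfolding zero_ell2_def by (subst Abs_ell2_inverse) auto

lemma coeff_add: "ell2_coeff (x + y) i = ell2_coeff x i + ell2_coeff y i"
  unfolding plus_ell2_def by (subst Abs_ell2_inverse) (use ell2_bounded(1)[OF ell2_L2_add] in auto)

lemma coeff_uminus: "ell2_coeff (- x) i = - ell2_coeff x i"
  unfolding uminus_ell2_def by (subst Abs_ell2_inverse) (auto simp: ell2_coeff_summable)

lemma coeff_minus: "ell2_coeff (x - y) i = ell2_coeff x i - ell2_coeff y i"
  by (simp add: minus_ell2_def coeff_add coeff_uminus)

lemma coeff_scaleC: "ell2_coeff (a *\<^sub>C x) i = a * ell2_coeff x i"
  unfolding scaleC_ell2_def by (subst Abs_ell2_inverse) (use ell2_scale_summable in auto)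

lemma coeff_scaleR: "ell2_coeff (r *\<^sub>R x) i = complex_of_real r * ell2_coeff x i"
  unfolding scaleR_ell2_def by (subst Abs_ell2_inverse) (use ell2_scale_summable in auto)

lemmas ell2_coeff_simps = coeff_zero coeff_add coeff_uminus coeff_minus coeff_scaleC coeff_scaleR

instance
proof
  fix x y z :: "'a ell2" and a b :: complex and r s :: real
  show "x + y + z = x + (y + z)" "x + y = y + x" "0 + x = x" "- x + x = 0" "x - y = x + - y"
    "r *\<^sub>R (x + y) = r *\<^sub>R x + r *\<^sub>R y" "(r + s) *\<^sub>R x = r *\<^sub>R x + s *\<^sub>R x"
    "r *\<^sub>R s *\<^sub>R x = (r * s) *\<^sub>R x" "1 *\<^sub>R x = x"
    "a *\<^sub>C (x + y) = a *\<^sub>C x + a *\<^sub>C y" "(a + b) *\<^sub>C x = a *\<^sub>C x + b *\<^sub>C x"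
    "a *\<^sub>C b *\<^sub>C x = (a * b) *\<^sub>C x" "1 *\<^sub>C x = x"
    "r *\<^sub>R x = complex_of_real r *\<^sub>C x"
    by (rule ell2_eqI, simp add: ell2_coeff_simps algebra_simps)+
qed

end

instantiation ell2 :: (type) complex_inner
begin

definition "cinner_ell2 x y = (\<Sum>\<^sub>\<infinity>i. ell2_coeff x i * cnj (ell2_coeff y i))"
definition "norm_ell2 x = ell2_norm x"
definition "sgn_ell2 x = inverse (norm x) *\<^sub>R (x :: 'a ell2)"
definition "dist_ell2 x y = norm (x - y :: 'a ell2)"
definition [code del]:
  "(uniformity :: ('a ell2 \<times> 'a ell2) filter) = (INF e\<in>{0<..}. principal {(x, y). dist x y < e})"
definition [code del]:
  "open (U :: 'a ell2 set) = (\<forall>x\<in>U. \<forall>\<^sub>F (x', y) in uniformity. x' = x \<longrightarrow> y \<in> U)"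

instance
proof
  fix x y z :: "'a ell2" and a :: complex and r :: real
  show "dist x y = norm (x - y)" "sgn x = x /\<^sub>R norm x"
    by (simp_all add: dist_ell2_def sgn_ell2_def)
  show "(uniformity :: ('a ell2 \<times> 'a ell2) filter) = (INF e\<in>{0<..}. principal {(x, y). dist x y < e})"
    by (rule uniformity_ell2_def)
  show "open U = (\<forall>x\<in>U. \<forall>\<^sub>F (x', y) in uniformity. x' = x \<longrightarrow> y \<in> U)" for U :: "'a ell2 set"
    by (rule open_ell2_def)
  show "(norm x = 0) = (x = 0)"
  proof
    assume "norm x = 0"
    then have "L2_set (\<lambda>i. cmod (ell2_coeff x i)) {i} \<le> 0" for i
      using ell2_norm_finite[of "{i}" x] by (simp add: norm_ell2_def)
    then show "x = 0"
      by (intro ell2_eqI) (simp add: coeff_zero L2_set_def)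
  qed (simp add: norm_ell2_def ell2_norm_def coeff_zero)
  show "norm (x + y) \<le> norm x + norm y"
    unfolding norm_ell2_def ell2_norm_def[of "x + y"] coeff_add
    by (rule ell2_bounded(2)[OF ell2_L2_add])
  show "norm (r *\<^sub>R x) = \<bar>r\<bar> * norm x"
    by (simp add: norm_ell2_def ell2_norm_def coeff_scaleR norm_mult power_mult_distrib
        infsum_cmult_right' real_sqrt_mult)
  show "cinner x y = cnj (cinner y x)"
    by (simp add: cinner_ell2_def mult.commute flip: infsum_cnj)
  show "cinner (x + y) z = cinner x z + cinner y z"
    by (simp add: cinner_ell2_def coeff_add distrib_right infsum_add ell2_cinner_summable)
  show "cinner (a *\<^sub>C x) y = a * cinner x y"
    by (simp add: cinner_ell2_def coeff_scaleC mult.assoc infsum_cmult_right')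
  have "(\<Sum>\<^sub>\<infinity>i. complex_of_real ((cmod (ell2_coeff x i))\<^sup>2))
      = complex_of_real (\<Sum>\<^sub>\<infinity>i. (cmod (ell2_coeff x i))\<^sup>2)"
    by (intro infsumI has_sum_of_real has_sum_infsum ell2_coeff_summable)
  moreover have "0 \<le> (\<Sum>\<^sub>\<infinity>i. (cmod (ell2_coeff x i))\<^sup>2)"
    by (simp add: infsum_nonneg)
  ultimately show "cinner x x = complex_of_real ((norm x)\<^sup>2)"
    by (simp add: cinner_ell2_def norm_ell2_def ell2_norm_def complex_norm_square del: of_real_power)
qed

end

instance ell2 :: (type) chilbert_space
proof
  fix X :: "nat \<Rightarrow> 'a ell2"
  assume X: "Cauchy X"
  have comp: "cmod (ell2_coeff x i) \<le> norm x" for x :: "'a ell2" and i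
    using ell2_norm_finite[of "{i}" x] by (simp add: norm_ell2_def)
  have "Cauchy (\<lambda>n. ell2_coeff (X n) i)" for i
  proof (rule CauchyI)
    fix e :: real assume "0 < e"
    then obtain M where "\<forall>m\<ge>M. \<forall>n\<ge>M. norm (X m - X n) < e"
      using CauchyD[OF X] by blast
    then show "\<exists>M. \<forall>m\<ge>M. \<forall>n\<ge>M. norm (ell2_coeff (X m) i - ell2_coeff (X n) i) < e"
      by (metis coeff_minus comp order_le_less_trans)
  qed
  then obtain c where c: "(\<lambda>n. ell2_coeff (X n) i) \<longlonglongrightarrow> c i" for i
    unfolding Cauchy_convergent_iff convergent_def by metis
  have tail: "L2_set (\<lambda>i. cmod (ell2_coeff (X n) i - c i)) F \<le> e"
    if M: "\<forall>m\<ge>M. \<forall>n\<ge>M. norm (X m - X n) < e" and "n \<ge> M" "finite F" for M n F e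
  proof (rule LIMSEQ_le_const2)
    show "(\<lambda>m. L2_set (\<lambda>i. cmod (ell2_coeff (X n) i - ell2_coeff (X m) i)) F)
        \<longlonglongrightarrow> L2_set (\<lambda>i. cmod (ell2_coeff (X n) i - c i)) F"
      unfolding L2_set_def by (intro tendsto_intros c)
    show "\<exists>N. \<forall>m\<ge>N. L2_set (\<lambda>i. cmod (ell2_coeff (X n) i - ell2_coeff (X m) i)) F \<le> e"
    proof (intro exI allI impI)
      fix m assume "m \<ge> M"
      have "L2_set (\<lambda>i. cmod (ell2_coeff (X n - X m) i)) F \<le> norm (X n - X m)"
        using ell2_norm_finite[OF \<open>finite F\<close>] by (simp add: norm_ell2_def)
      also have "\<dots> \<le> e"
        using M \<open>n \<ge> M\<close> \<open>m \<ge> M\<close> less_imp_le by blast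
      finally show "L2_set (\<lambda>i. cmod (ell2_coeff (X n) i - ell2_coeff (X m) i)) F \<le> e"
        by (simp add: coeff_minus)
    qed
  qed
  obtain M where M: "\<forall>m\<ge>M. \<forall>n\<ge>M. norm (X m - X n) < 1"
    using CauchyD[OF X, of 1] by auto
  define d where "d = Abs_ell2 (\<lambda>i. ell2_coeff (X M) i - c i)"
  have d: "ell2_coeff d i = ell2_coeff (X M) i - c i" for i
    unfolding d_def by (subst Abs_ell2_inverse) (use ell2_bounded(1)[OF tail[OF M]] in auto)
  define L where "L = X M - d"
  have L: "ell2_coeff L i = c i" for i
    by (simp add: L_def coeff_minus d)
  have "X \<longlonglongrightarrow> L"
  proof (rule LIMSEQ_I)
    fix e :: real assume "0 < e"
    then obtain N where N: "\<forall>m\<ge>N. \<forall>n\<ge>N. norm (X m - X n) < e / 2"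
      using CauchyD[OF X, of "e/2"] by auto
    have "norm (X n - L) \<le> e / 2" if "n \<ge> N" for n
      using ell2_bounded(2)[OF tail[OF N that]]
      by (simp add: norm_ell2_def ell2_norm_def coeff_minus L)
    then show "\<exists>N. \<forall>n\<ge>N. norm (X n - L) < e"
      using \<open>0 < e\<close> by (metis field_sum_of_halves less_add_same_cancel1 half_gt_zero order_le_less_trans)
  qed
  then show "convergent X"
    by (auto simp: convergent_def)
qed

definition orthonormal_set :: "'a::complex_inner set \<Rightarrow> bool" where
  "orthonormal_set B \<longleftrightarrow> (\<forall>x\<in>B. \<forall>y\<in>B. cinner x y = (if x = y then 1 else 0))"

text \<open>Meaningful for closed subspaces \<open>M\<close> only: these have an orthonormal basis, and the value does not
  depend on the one chosen. All infinite cardinalities are identified.\<close>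

definition hdim :: "'a::chilbert_space set \<Rightarrow> enat" where
  "hdim M = (let B = (SOME B. orthonormal_set B \<and> closure (cspan B) = M)
             in if finite B then enat (card B) else \<infinity>)"

definition ortho_compl :: "'a::complex_inner set \<Rightarrow> 'a set" where
  "ortho_compl A = {x. \<forall>a\<in>A. cinner x a = 0}"

definition orthonormal_basis :: "('i \<Rightarrow> 'a::chilbert_space) \<Rightarrow> bool" where
  "orthonormal_basis v \<longleftrightarrow>
     (\<forall>i j. cinner (v i) (v j) = (if i = j then 1 else 0)) \<and> closure (cspan (range v)) = UNIV"

definition closed_span :: "('i \<Rightarrow> 'a::chilbert_space) \<Rightarrow> 'a set" where
  "closed_span w = closure (cspan (range w))"

text \<open>The summability clause is needed since an infinite sum that diverges has the value 0.\<close>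

definition frame_bounds :: "'a::chilbert_space set \<Rightarrow> ('i \<Rightarrow> 'a) \<Rightarrow> real \<Rightarrow> real \<Rightarrow> bool" where
  "frame_bounds M f A B \<longleftrightarrow> range f \<subseteq> M \<and>
     (\<forall>x\<in>M. (\<lambda>i. (cmod (cinner x (f i)))\<^sup>2) summable_on UNIV \<and>
        A * (norm x)\<^sup>2 \<le> (\<Sum>\<^sub>\<infinity>i. (cmod (cinner x (f i)))\<^sup>2) \<and>
        (\<Sum>\<^sub>\<infinity>i. (cmod (cinner x (f i)))\<^sup>2) \<le> B * (norm x)\<^sup>2)"

definition frame_for :: "'a::chilbert_space set \<Rightarrow> ('i \<Rightarrow> 'a) \<Rightarrow> bool" where
  "frame_for M f \<longleftrightarrow> (\<exists>A B. 0 < A \<and> A \<le> B \<and> frame_bounds M f A B)"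

definition parseval_frame_for :: "'a::chilbert_space set \<Rightarrow> ('i \<Rightarrow> 'a) \<Rightarrow> bool" where
  "parseval_frame_for M f \<longleftrightarrow> frame_bounds M f 1 1"

definition frame_sequence :: "('i \<Rightarrow> 'a::chilbert_space) \<Rightarrow> bool" where
  "frame_sequence w \<longleftrightarrow> frame_for (closed_span w) w"

definition frame_op :: "('i \<Rightarrow> 'a::chilbert_space) \<Rightarrow> 'a \<Rightarrow> 'a" where
  "frame_op w g = (\<Sum>\<^sub>\<infinity>j. cinner g (w j) *\<^sub>C w j)"

text \<open>For a frame sequence \<open>w\<close> the series in \<open>frame_op\<close> converges and \<open>frame_op w\<close> maps the closed
  span of \<open>w\<close> bijectively onto itself.\<close>

definition canonical_dual :: "('i \<Rightarrow> 'a::chilbert_space) \<Rightarrow> 'i \<Rightarrow> 'a" where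
  "canonical_dual w j = the_inv_into (closed_span w) (frame_op w) (w j)"

definition synthesis :: "('i \<Rightarrow> 'a::chilbert_space) \<Rightarrow> 'i ell2 \<Rightarrow> 'a" where
  "synthesis y c = (\<Sum>\<^sub>\<infinity>i. ell2_coeff c i *\<^sub>C y i)"

text \<open>The summability clause only excludes divergent sums (whose formal value is 0);
  it holds for every \<open>c\<close> if \<open>y\<close> is a Bessel sequence.\<close>

definition synthesis_ker :: "('i \<Rightarrow> 'a::chilbert_space) \<Rightarrow> 'i ell2 set" where
  "synthesis_ker y = {c. (\<lambda>i. ell2_coeff c i *\<^sub>C y i) summable_on UNIV \<and> synthesis y c = 0}"

definition gram :: "('i \<Rightarrow> 'a::complex_inner) \<Rightarrow> ('j \<Rightarrow> 'a) \<Rightarrow> 'i \<Rightarrow> 'j \<Rightarrow> complex" where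
  "gram g h i j = cinner (g i) (h j)"

text \<open>The matrix equation $(A^t - \mathcal{I}) B = 0$ with convergent entries, read as $A^t B = B$.\<close>

definition transpose_fixes :: "('i \<Rightarrow> 'i \<Rightarrow> complex) \<Rightarrow> ('i \<Rightarrow> 'j \<Rightarrow> complex) \<Rightarrow> bool" where
  "transpose_fixes A B \<longleftrightarrow> (\<forall>i j. ((\<lambda>k. A k i * B k j) has_sum B i j) UNIV)"

definition weak_R_dual ::
  "('i \<Rightarrow> 'a::chilbert_space) \<Rightarrow> ('i \<Rightarrow> 'a) \<Rightarrow> ('i \<Rightarrow> 'a) \<Rightarrow> ('i \<Rightarrow> 'a) \<Rightarrow> bool" where
  "weak_R_dual w f u v \<longleftrightarrow>
     parseval_frame_for UNIV u \<and> parseval_frame_for UNIV v \<and>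
     (\<forall>j. (\<lambda>i. (cmod (cinner (f i) (u j)))\<^sup>2) summable_on UNIV) \<and>
     transpose_fixes (gram v v) (gram f u) \<and>
     (\<forall>j. ((\<lambda>i. cinner (f i) (u j) *\<^sub>C v i) has_sum w j) UNIV)"

end

theory Submission
  imports Defs
begin

text \<open>Let \<open>M\<close> be the closed span of \<open>w\<close>. If \<open>w\<close> is a weak R-dual with respect to \<open>u\<close> and \<open>v\<close>, then
  \<open>cinner (w j) (v i) = cinner (f i) (u j)\<close>, so \<open>y i\<close> is the orthogonal projection of \<open>v i\<close> onto \<open>M\<close>.
  Hence the kernel of the synthesis operator of \<open>y\<close> is the orthogonal sum of the image of
  \<open>ortho_compl M\<close> under the (isometric) analysis operator of \<open>v\<close> and the kernel of the synthesis
  operator of \<open>v\<close>, and the latter vanishes iff \<open>v\<close> is an orthonormal basis. Conversely, every isometry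
  from \<open>ortho_compl M\<close> into the kernel of the synthesis operator of \<open>y\<close> is the analysis operator of a
  Parseval frame \<open>z\<close> for \<open>ortho_compl M\<close>, and \<open>v i = y i + z i\<close> is then a Parseval frame with
  respect to which \<open>w\<close> is a weak R-dual; it is an orthonormal basis iff the isometry is onto.\<close>

section \<open>Inner products and Bessel sequences\<close>

lemma cinner_add_right: "cinner x (y + z) = cinner x y + cinner x z"
  by (metis cinner_commute cinner_add_left complex_cnj_add)

lemma cinner_scaleC_right: "cinner x (a *\<^sub>C y) = cnj a * cinner x y"
  by (metis cinner_commute cinner_scaleC_left complex_cnj_mult)

lemma cinner_zero_left [simp]: "cinner 0 x = 0"
  using cinner_add_left[of 0 0 x] by simp

lemma cinner_zero_right [simp]: "cinner x 0 = 0"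
  by (metis cinner_commute cinner_zero_left complex_cnj_zero)

lemma cinner_minus_left: "cinner (- x) y = - cinner x y"
  by (metis add.right_inverse cinner_add_left cinner_zero_left minus_unique)

lemma cinner_diff_left: "cinner (x - y) z = cinner x z - cinner y z"
  by (metis cinner_add_left cinner_minus_left diff_conv_add_uminus)

lemma cinner_diff_right: "cinner x (y - z) = cinner x y - cinner x z"
  by (metis cinner_commute cinner_diff_left complex_cnj_diff)

lemma cinner_sum_left: "cinner (\<Sum>i\<in>F. g i) y = (\<Sum>i\<in>F. cinner (g i) y)"
  by (induction F rule: infinite_finite_induct) (simp_all add: cinner_add_left)

lemma cinner_sum_right: "cinner x (\<Sum>i\<in>F. g i) = (\<Sum>i\<in>F. cinner x (g i))"
  by (induction F rule: infinite_finite_induct) (simp_all add: cinner_add_right)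

lemma cmod_cinner_commute: "cmod (cinner x y) = cmod (cinner y x)"
  by (metis cinner_commute complex_mod_cnj)

lemma cinner_eq_zero_commute: "cinner x y = 0 \<longleftrightarrow> cinner y x = 0"
  by (metis cinner_commute complex_cnj_zero)

lemma cinner_self_eq_zero [simp]: "cinner x x = 0 \<longleftrightarrow> x = 0"
  by (simp add: cinner_self)

lemma Re_cinner_self: "Re (cinner x x) = (norm x)\<^sup>2"
  by (simp add: cinner_self)

lemma norm_scaleC: "norm (a *\<^sub>C x) = cmod a * norm (x :: 'a::complex_inner)"
proof -
  have "complex_of_real ((norm (a *\<^sub>C x))\<^sup>2) = complex_of_real ((cmod a * norm x)\<^sup>2)"
    by (simp add: cinner_self[symmetric] cinner_scaleC_left cinner_scaleC_right power_mult_distrib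
        complex_norm_square ac_simps del: of_real_power)
  then show ?thesis
    by (metis norm_ge_zero of_real_eq_iff power2_eq_iff_nonneg mult_nonneg_nonneg)
qed

lemma norm_diff_square:
  "(norm (x - y))\<^sup>2 = (norm x)\<^sup>2 - 2 * Re (cinner x y) + (norm (y :: 'a::complex_inner))\<^sup>2"
proof -
  have "Re (cinner y x) = Re (cinner x y)"
    by (metis cinner_commute cnj.simps(1))
  then show ?thesis
    by (simp add: Re_cinner_self[symmetric] cinner_diff_left cinner_diff_right algebra_simps)
qed

lemma norm_add_square:
  assumes "cinner x y = 0"
  shows "(norm (x + y))\<^sup>2 = (norm x)\<^sup>2 + (norm (y :: 'a::complex_inner))\<^sup>2"
  using assms cinner_eq_zero_commute[of x y]
  by (simp add: Re_cinner_self[symmetric] cinner_add_left cinner_add_right)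

text \<open>Pythagoras for the splitting of \<open>x\<close> into \<open>a *\<^sub>C y\<close>, its
  component along \<open>y\<close>, and an orthogonal remainder.\<close>

lemma cauchy_schwarz: "cmod (cinner x y) \<le> norm x * norm (y :: 'a::complex_inner)"
proof (cases "y = 0")
  case False
  define a where "a = cinner x y / complex_of_real ((norm y)\<^sup>2)"
  have "cinner (x - a *\<^sub>C y) (a *\<^sub>C y) = 0"
    using False by (simp add: cinner_diff_left cinner_scaleC_left cinner_scaleC_right cinner_self a_def
        del: of_real_power)
  from norm_add_square[OF this] have "(norm (a *\<^sub>C y))\<^sup>2 \<le> (norm x)\<^sup>2"
    by simp
  then have "cmod a * norm y \<le> norm x"
    by (simp add: norm_scaleC)
  then show ?thesis
    using False by (simp add: a_def norm_divide norm_mult power2_eq_square field_simps)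
qed simp

lemma cinner_scaleR_left: "cinner (r *\<^sub>R x) y = r *\<^sub>R cinner x y"
  by (simp add: scaleR_scaleC cinner_scaleC_left scaleR_conv_of_real)

lemma cinner_scaleR_right: "cinner x (r *\<^sub>R y) = r *\<^sub>R cinner x y"
  by (simp add: scaleR_scaleC cinner_scaleC_right scaleR_conv_of_real)

lemma bounded_bilinear_cinner:
  "bounded_bilinear (cinner :: 'a::complex_inner \<Rightarrow> 'a \<Rightarrow> complex)"
  by unfold_locales
    (auto simp: cinner_add_left cinner_add_right cinner_scaleR_left cinner_scaleR_right
      intro!: exI[of _ 1] cauchy_schwarz)

lemma bounded_bilinear_scaleC:
  "bounded_bilinear (scaleC :: complex \<Rightarrow> 'a::complex_inner \<Rightarrow> 'a)"
proof
  fix a a' :: complex and b b' :: 'a and r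
  show "(a + a') *\<^sub>C b = a *\<^sub>C b + a' *\<^sub>C b" "a *\<^sub>C (b + b') = a *\<^sub>C b + a *\<^sub>C b'"
    by (simp_all add: scaleC_add_left scaleC_add_right)
  show "(r *\<^sub>R a) *\<^sub>C b = r *\<^sub>R a *\<^sub>C b" "a *\<^sub>C (r *\<^sub>R b) = r *\<^sub>R a *\<^sub>C b"
    by (simp_all add: scaleR_scaleC scaleC_scaleC scaleR_conv_of_real mult.commute)
qed (auto simp: norm_scaleC intro!: exI[of _ 1])

lemmas bounded_linear_cinner_left = bounded_bilinear.bounded_linear_left[OF bounded_bilinear_cinner]
lemma has_sum_cinner_left:
  "(g has_sum s) A \<Longrightarrow> ((\<lambda>i. cinner (g i) y) has_sum cinner s (y :: 'a::complex_inner)) A"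
  by (rule has_sum_bounded_linear[OF bounded_linear_cinner_left])

section \<open>Closed complex subspaces and orthogonal complements\<close>

abbreviation csubspace :: "'a::complex_vector set \<Rightarrow> bool" where
  "csubspace \<equiv> complex_vector.subspace"

lemma csubspace_ortho_compl: "csubspace (ortho_compl A)"
  by (auto simp: complex_vector.subspace_def ortho_compl_def cinner_add_left cinner_scaleC_left)

lemma closed_ortho_compl: "closed (ortho_compl (A :: 'a::complex_inner set))"
proof -
  have "ortho_compl A = (\<Inter>a\<in>A. (\<lambda>x. cinner x a) -` {0})"
    by (auto simp: ortho_compl_def)
  moreover have "closed ((\<lambda>x. cinner x a) -` {0})" for a :: 'a
    by (intro closed_vimage bounded_linear.continuous_on[OF bounded_linear_cinner_left]) auto
  ultimately show ?thesis
    by auto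
qed

lemma csubspace_closure:
  assumes "csubspace (A :: 'a::complex_inner set)"
  shows "csubspace (closure A)"
proof (rule complex_vector.subspaceI)
  show "0 \<in> closure A"
    using closure_subset complex_vector.subspace_0[OF assms] by blast
next
  fix x y assume "x \<in> closure A" "y \<in> closure A"
  then obtain X Y where "range X \<subseteq> A" "X \<longlonglongrightarrow> x" "range Y \<subseteq> A" "Y \<longlonglongrightarrow> y"
    unfolding closure_sequential by blast
  then show "x + y \<in> closure A"
    unfolding closure_sequential using complex_vector.subspace_add[OF assms]
    by (intro exI[of _ "\<lambda>n. X n + Y n"]) (auto intro: tendsto_add)
next
  fix c x assume "x \<in> closure A"
  then obtain X where "range X \<subseteq> A" "X \<longlonglongrightarrow> x"
    unfolding closure_sequential by blast
  then show "c *\<^sub>C x \<in> closure A"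
    unfolding closure_sequential using complex_vector.subspace_scale[OF assms]
    by (intro exI[of _ "\<lambda>n. c *\<^sub>C X n"])
       (auto intro: bounded_linear.tendsto[OF bounded_bilinear.bounded_linear_right[OF bounded_bilinear_scaleC]])
qed

text \<open>\<open>ortho_compl {x}\<close> is a closed subspace containing \<open>B\<close>, so
  orthogonality can be tested on generators.\<close>

lemma orthogonal_closure_cspan:
  assumes "\<And>b. b \<in> B \<Longrightarrow> cinner x b = 0" "m \<in> closure (cspan B)"
  shows "cinner x (m :: 'a::complex_inner) = 0"
proof -
  have "B \<subseteq> ortho_compl {x}"
    using assms(1) cinner_eq_zero_commute by (auto simp: ortho_compl_def)
  then have "closure (cspan B) \<subseteq> ortho_compl {x}"
    by (intro closure_minimal complex_vector.span_minimal csubspace_ortho_compl closed_ortho_compl)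
  then show ?thesis
    using assms(2) cinner_eq_zero_commute by (auto simp: ortho_compl_def)
qed

lemma ortho_compl_cspan: "ortho_compl (cspan A) = ortho_compl (closure (cspan (A :: 'a::complex_inner set)))"
  using orthogonal_closure_cspan[of A] closure_subset[of "cspan A"] complex_vector.span_superset[of A]
  unfolding ortho_compl_def by blast

lemma has_sum_mem_closed_csubspace:
  assumes "(g has_sum s) A" "csubspace M" "closed M" "\<And>i. i \<in> A \<Longrightarrow> g i \<in> M"
  shows "(s :: 'a::complex_inner) \<in> M"
proof (rule Lim_in_closed_set[OF assms(3)])
  show "(sum g \<longlongrightarrow> s) (finite_subsets_at_top A)"
    using assms(1) by (simp add: has_sum_def)
  show "\<forall>\<^sub>F F in finite_subsets_at_top A. sum g F \<in> M"
    by (rule eventually_finite_subsets_at_top_weakI)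
       (use assms(4) in \<open>auto intro!: complex_vector.subspace_sum[OF assms(2)]\<close>)
qed simp

text \<open>A bound on the synthesis operator, stated for finite sums so that convergence becomes a
  consequence; \<open>K\<close> is the square root of a usual Bessel bound. The index set
  \<open>J\<close> lets orthonormal sets be indexed by their own elements.\<close>

definition bessel :: "'j set \<Rightarrow> ('j \<Rightarrow> 'a::complex_inner) \<Rightarrow> real \<Rightarrow> bool" where
  "bessel J f K \<longleftrightarrow> 0 \<le> K \<and>
     (\<forall>c F. finite F \<longrightarrow> F \<subseteq> J \<longrightarrow>
        norm (\<Sum>i\<in>F. c i *\<^sub>C f i) \<le> K * L2_set (\<lambda>i. cmod (c i)) F)"

lemma besselD: "bessel J f K \<Longrightarrow> finite F \<Longrightarrow> F \<subseteq> J \<Longrightarrow>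
    norm (\<Sum>i\<in>F. c i *\<^sub>C f i) \<le> K * L2_set (\<lambda>i. cmod (c i)) F"
  by (auto simp: bessel_def)

lemma bessel_nonneg: "bessel J f K \<Longrightarrow> 0 \<le> K"
  by (simp add: bessel_def)

text \<open>Pairing the finite sum with itself and applying Cauchy-Schwarz turns an analysis bound
  into the synthesis bound. The sum stays in \<open>M\<close>, so the analysis bound is only
  required there.\<close>

lemma bessel_subspaceI:
  assumes "csubspace M" "\<And>i. i \<in> J \<Longrightarrow> f i \<in> M" "0 \<le> K"
    and bound: "\<And>x F. x \<in> M \<Longrightarrow> finite F \<Longrightarrow> F \<subseteq> J \<Longrightarrow>
      L2_set (\<lambda>i. cmod (cinner x (f i))) F \<le> K * norm x"
  shows "bessel J f K"
  unfolding bessel_def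
proof (intro conjI allI impI \<open>0 \<le> K\<close>)
  fix c F assume F: "finite F" "F \<subseteq> J"
  define x where "x = (\<Sum>i\<in>F. c i *\<^sub>C f i)"
  have "x \<in> M"
    unfolding x_def using assms(2) F
    by (intro complex_vector.subspace_sum[OF assms(1)] complex_vector.subspace_scale[OF assms(1)]) auto
  have "cinner x x = (\<Sum>i\<in>F. c i * cinner (f i) x)"
    by (subst x_def) (simp add: cinner_sum_left cinner_scaleC_left)
  then have "(norm x)\<^sup>2 = cmod (\<Sum>i\<in>F. c i * cinner (f i) x)"
    by (metis cinner_self norm_of_real abs_of_nonneg zero_le_power2)
  also have "\<dots> \<le> (\<Sum>i\<in>F. \<bar>cmod (c i)\<bar> * \<bar>cmod (cinner x (f i))\<bar>)"
    by (rule order_trans[OF norm_sum]) (simp add: norm_mult cmod_cinner_commute)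
  also have "\<dots> \<le> L2_set (\<lambda>i. cmod (c i)) F * L2_set (\<lambda>i. cmod (cinner x (f i))) F"
    by (rule L2_set_mult_ineq)
  also have "\<dots> \<le> L2_set (\<lambda>i. cmod (c i)) F * (K * norm x)"
    by (intro mult_left_mono bound \<open>x \<in> M\<close> F L2_set_nonneg)
  finally have "norm x * norm x \<le> (K * L2_set (\<lambda>i. cmod (c i)) F) * norm x"
    by (simp add: power2_eq_square ac_simps)
  then show "norm x \<le> K * L2_set (\<lambda>i. cmod (c i)) F"
    using \<open>0 \<le> K\<close> by (cases "x = 0") (simp_all add: L2_set_nonneg)
qed

text \<open>The converse estimate, on the whole space: with the coefficients
  \<open>cinner x (f i)\<close>, the pairing of \<open>x\<close> with the finite sum is the square
  of the left side.\<close>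

lemma bessel_analysis_finite:
  assumes "bessel J f K" "finite F" "F \<subseteq> J"
  shows "L2_set (\<lambda>i. cmod (cinner x (f i))) F \<le> K * norm x"
proof -
  define s where "s = (\<Sum>i\<in>F. cinner x (f i) *\<^sub>C f i)"
  define L where "L = L2_set (\<lambda>i. cmod (cinner x (f i))) F"
  have "complex_of_real (L\<^sup>2) = (\<Sum>i\<in>F. complex_of_real ((cmod (cinner x (f i)))\<^sup>2))"
    by (simp add: L_def L2_set_def sum_nonneg)
  also have "\<dots> = cinner x s"
    unfolding s_def cinner_sum_right cinner_scaleC_right
    by (rule sum.cong) (simp_all add: complex_norm_square mult.commute del: of_real_power)
  finally have "complex_of_real (L\<^sup>2) = cinner x s" .
  then have "L\<^sup>2 = cmod (cinner x s)"
    by (metis abs_of_nonneg norm_of_real zero_le_power2)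
  also have "\<dots> \<le> norm x * (K * L)"
    using order_trans[OF cauchy_schwarz mult_left_mono[OF besselD[OF assms, of "\<lambda>i. cinner x (f i)"]]]
    by (simp add: s_def L_def)
  finally have "L * L \<le> (K * norm x) * L"
    by (simp add: power2_eq_square ac_simps)
  then show ?thesis
    using bessel_nonneg[OF assms(1)] L2_set_nonneg[of "\<lambda>i. cmod (cinner x (f i))" F]
    unfolding L_def[symmetric] by (cases "L = 0") simp_all
qed

lemma L2_set_bounded:
  assumes "\<And>F. finite F \<Longrightarrow> F \<subseteq> J \<Longrightarrow> L2_set g F \<le> B"
  shows "(\<lambda>i. (g i)\<^sup>2) summable_on J" and "(\<Sum>\<^sub>\<infinity>i\<in>J. (g i)\<^sup>2) \<le> B\<^sup>2"
proof -
  have *: "(\<Sum>i\<in>F. (g i)\<^sup>2) \<le> B\<^sup>2" if "finite F" "F \<subseteq> J" for F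
    using assms[OF that] assms[of "{}"] unfolding L2_set_def
    by (simp add: real_sqrt_le_iff' sum_nonneg sqrt_le_D)
  show s: "(\<lambda>i. (g i)\<^sup>2) summable_on J"
    by (rule nonneg_bdd_above_summable_on) (use * in \<open>auto intro!: bdd_aboveI\<close>)
  show "(\<Sum>\<^sub>\<infinity>i\<in>J. (g i)\<^sup>2) \<le> B\<^sup>2"
    by (rule infsum_le_finite_sums[OF s]) (use * in auto)
qed

lemma bessel_analysis:
  assumes "bessel J f K"
  shows "(\<lambda>i. (cmod (cinner x (f i)))\<^sup>2) summable_on J"
    and "(\<Sum>\<^sub>\<infinity>i\<in>J. (cmod (cinner x (f i)))\<^sup>2) \<le> (K * norm x)\<^sup>2"
  using L2_set_bounded[of J "\<lambda>i. cmod (cinner x (f i))"] bessel_analysis_finite[OF assms] by blast+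

text \<open>Square summability makes the coefficients outside a large finite set small, so the
  partial sums form a Cauchy filter and completeness gives a limit; the norm bound is inherited from
  the finite sums.\<close>

lemma bessel_synthesis:
  fixes f :: "'j \<Rightarrow> 'a::chilbert_space"
  assumes "bessel J f K" and c: "(\<lambda>i. (cmod (c i))\<^sup>2) summable_on J"
  shows "(\<lambda>i. c i *\<^sub>C f i) summable_on J"
    and "norm (\<Sum>\<^sub>\<infinity>i\<in>J. c i *\<^sub>C f i) \<le> K * sqrt (\<Sum>\<^sub>\<infinity>i\<in>J. (cmod (c i))\<^sup>2)"
proof -
  let ?g = "\<lambda>i. c i *\<^sub>C f i" and ?T = "\<Sum>\<^sub>\<infinity>i\<in>J. (cmod (c i))\<^sup>2"
  have "\<exists>P. eventually P (finite_subsets_at_top J) \<and>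
          (\<forall>F F'. P F \<and> P F' \<longrightarrow> dist (sum ?g F) (sum ?g F') < e)" if "e > 0" for e
  proof -
    \<comment> \<open>Two tails of size at most \<open>K * d\<close> will add up to less than
      \<open>e\<close>; the summand 1 keeps the denominator positive when
      \<open>K = 0\<close>.\<close>
    define d where "d = e / (2 * (K + 1))"
    have K: "0 \<le> K" and "d > 0"
      using bessel_nonneg[OF assms(1)] \<open>e > 0\<close> by (auto simp: d_def)
    obtain F0 where F0: "finite F0" "F0 \<subseteq> J" "dist (\<Sum>i\<in>F0. (cmod (c i))\<^sup>2) ?T \<le> d\<^sup>2 / 2"
      using infsum_finite_approximation[OF c, of "d\<^sup>2 / 2"] \<open>d > 0\<close> by auto
    have tail: "norm (sum ?g G) \<le> K * d" if "finite G" "G \<subseteq> J" "G \<inter> F0 = {}" for G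
    proof -
      have "(\<Sum>i\<in>G \<union> F0. (cmod (c i))\<^sup>2) \<le> ?T"
        by (rule finite_sum_le_infsum[OF c]) (use that F0 in auto)
      then have "(\<Sum>i\<in>G. (cmod (c i))\<^sup>2) \<le> d\<^sup>2"
        using F0 that zero_le_power2[of d] unfolding sum.union_disjoint[OF that(1) F0(1) that(3)] dist_real_def
        by linarith
      then have "L2_set (\<lambda>i. cmod (c i)) G \<le> d"
        using \<open>d > 0\<close> by (simp add: L2_set_def real_le_lsqrt)
      then show ?thesis
        using besselD[OF assms(1) that(1,2), of c] mult_left_mono[OF _ K] order_trans by blast
    qed
    have "dist (sum ?g F) (sum ?g F') < e"
      if "finite F \<and> F0 \<subseteq> F \<and> F \<subseteq> J" "finite F' \<and> F0 \<subseteq> F' \<and> F' \<subseteq> J" for F F'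
    proof -
      \<comment> \<open>The common part \<open>F \<inter> F'\<close> cancels in the difference,
        leaving two sums over sets disjoint from \<open>F0\<close>.\<close>
      have split: "sum ?g F = sum ?g (F \<inter> F') + sum ?g (F - F')" "sum ?g F' = sum ?g (F \<inter> F') + sum ?g (F' - F)"
        using that by (auto simp: sum.Int_Diff[of F ?g F'] sum.Int_Diff[of F' ?g F] Int_commute)
      have "dist (sum ?g F) (sum ?g F') = norm (sum ?g (F - F') - sum ?g (F' - F))"
        by (simp add: dist_norm split)
      also have "\<dots> \<le> K * d + K * d"
        by (rule order_trans[OF norm_triangle_ineq4]) (intro add_mono tail; use that in auto)
      also have "\<dots> < 2 * (K + 1) * d"
        using \<open>d > 0\<close> by (simp add: algebra_simps)
      also have "\<dots> = e"
        using K by (simp add: d_def)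
      finally show ?thesis .
    qed
    moreover have "eventually (\<lambda>F. finite F \<and> F0 \<subseteq> F \<and> F \<subseteq> J) (finite_subsets_at_top J)"
      using F0 by (auto simp: eventually_finite_subsets_at_top)
    ultimately show ?thesis
      by (intro exI[of _ "\<lambda>F. finite F \<and> F0 \<subseteq> F \<and> F \<subseteq> J"]) blast
  qed
  then have "cauchy_filter (filtermap (sum ?g) (finite_subsets_at_top J))"
    by (simp add: cauchy_filter_metric_filtermap)
  moreover have "complete (UNIV::'a set)"
    by (meson Cauchy_convergent UNIV_I complete_def convergent_def)
  ultimately obtain L' where "(sum ?g \<longlongrightarrow> L') (finite_subsets_at_top J)"
    using complete_uniform[where S=UNIV] by (force simp add: filterlim_def)
  then show s: "?g summable_on J"
    using summable_on_def has_sum_def by blast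
  have "(sum ?g \<longlongrightarrow> infsum ?g J) (finite_subsets_at_top J)"
    using s by (simp add: infsum_tendsto)
  then have "((\<lambda>F. norm (sum ?g F)) \<longlongrightarrow> norm (infsum ?g J)) (finite_subsets_at_top J)"
    by (rule tendsto_norm)
  then show "norm (infsum ?g J) \<le> K * sqrt ?T"
  proof (rule tendsto_upperbound)
    show "\<forall>\<^sub>F F in finite_subsets_at_top J. norm (sum ?g F) \<le> K * sqrt ?T"
    proof (rule eventually_finite_subsets_at_top_weakI)
      fix F assume F: "finite F" "F \<subseteq> J"
      have "L2_set (\<lambda>i. cmod (c i)) F \<le> sqrt ?T"
        unfolding L2_set_def using finite_sum_le_infsum[OF c F] by simp
      then show "norm (sum ?g F) \<le> K * sqrt ?T"
        using besselD[OF assms(1) F, of c] mult_left_mono[OF _ bessel_nonneg[OF assms(1)]] order_trans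
        by blast
    qed
  qed simp
qed

section \<open>Orthonormal sets and analysis operators\<close>

definition orthonormal_on :: "'j set \<Rightarrow> ('j \<Rightarrow> 'a::complex_inner) \<Rightarrow> bool" where
  "orthonormal_on J e \<longleftrightarrow> (\<forall>i\<in>J. \<forall>j\<in>J. cinner (e i) (e j) = (if i = j then 1 else 0))"

lemma orthonormal_setD: "orthonormal_set B \<Longrightarrow> orthonormal_on B (\<lambda>b. b)"
  by (simp add: orthonormal_set_def orthonormal_on_def)

lemma orthonormal_set_image: "orthonormal_on J e \<Longrightarrow> orthonormal_set (e ` J)"
  unfolding orthonormal_set_def orthonormal_on_def by (metis imageE one_neq_zero)

lemma orthonormal_on_inj: "orthonormal_on J e \<Longrightarrow> inj_on e J"
  unfolding orthonormal_on_def inj_on_def by (metis one_neq_zero)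

lemma orthonormal_set_subset: "orthonormal_set B \<Longrightarrow> A \<subseteq> B \<Longrightarrow> orthonormal_set A"
  unfolding orthonormal_set_def by blast

lemma has_sum_single:
  assumes "a \<in> A" "\<And>i. i \<in> A \<Longrightarrow> i \<noteq> a \<Longrightarrow> g i = 0"
  shows "(g has_sum g a) A"
proof -
  have "(g has_sum g a) {a}"
    using has_sum_finite[of "{a}" g] by simp
  then show ?thesis
    by (rule has_sum_cong_neutral[THEN iffD1, rotated -1]) (use assms in auto)
qed

text \<open>By orthonormality, the norm of a finite combination equals the \<open>L2_set\<close>
  norm of its coefficients.\<close>

lemma orthonormal_on_bessel:
  assumes "orthonormal_on J e"
  shows "bessel J e 1"
  unfolding bessel_def
proof (intro conjI allI impI)
  fix c F assume F: "finite F" "F \<subseteq> J"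
  let ?s = "\<Sum>i\<in>F. c i *\<^sub>C e i"
  have "cinner ?s (e j) = c j" if "j \<in> F" for j
  proof -
    have "cinner ?s (e j) = (\<Sum>i\<in>F. if i = j then c i else 0)"
      unfolding cinner_sum_left cinner_scaleC_left using assms subsetD[OF F(2)] that
      by (intro sum.cong) (simp_all add: orthonormal_on_def)
    then show ?thesis
      using F that by simp
  qed
  then have "cinner ?s ?s = (\<Sum>i\<in>F. complex_of_real ((cmod (c i))\<^sup>2))"
    unfolding cinner_sum_right cinner_scaleC_right
    by (intro sum.cong) (simp_all add: complex_norm_square mult.commute del: of_real_power)
  then have "(norm ?s)\<^sup>2 = (\<Sum>i\<in>F. (cmod (c i))\<^sup>2)"
    by (metis cinner_self of_real_eq_iff of_real_sum)
  then show "norm ?s \<le> 1 * L2_set (\<lambda>i. cmod (c i)) F"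
    by (simp add: L2_set_def real_le_rsqrt)
qed simp

lemma orthonormal_on_coeff:
  assumes "orthonormal_on J e" "((\<lambda>i. c i *\<^sub>C e i) has_sum s) J" "j \<in> J"
  shows "cinner s (e j) = c j"
proof -
  have "((\<lambda>i. cinner (c i *\<^sub>C e i) (e j)) has_sum cinner (c j *\<^sub>C e j) (e j)) J"
    by (rule has_sum_single) (use assms in \<open>auto simp: cinner_scaleC_left orthonormal_on_def\<close>)
  from has_sum_unique[OF has_sum_cinner_left[OF assms(2)] this] show ?thesis
    using assms(1,3) by (simp add: cinner_scaleC_left orthonormal_on_def)
qed

text \<open>\<open>p\<close> is the Fourier series of \<open>x\<close>. Its coefficients agree with
  those of \<open>x\<close>, so \<open>x - p\<close> is orthogonal to every element of
  \<open>B\<close> and hence to the closed span.\<close>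

lemma orthonormal_projection:
  fixes B :: "'a::chilbert_space set"
  assumes "orthonormal_set B"
  obtains p where "((\<lambda>b. cinner x b *\<^sub>C b) has_sum p) B" "p \<in> closure (cspan B)"
    "\<And>m. m \<in> closure (cspan B) \<Longrightarrow> cinner (x - p) m = 0"
proof -
  note on = orthonormal_setD[OF assms]
  define p where "p = (\<Sum>\<^sub>\<infinity>b\<in>B. cinner x b *\<^sub>C b)"
  have p: "((\<lambda>b. cinner x b *\<^sub>C b) has_sum p) B"
    unfolding p_def
    by (intro has_sum_infsum bessel_synthesis(1)[OF orthonormal_on_bessel[OF on]]
        bessel_analysis(1)[OF orthonormal_on_bessel[OF on]])
  show ?thesis
  proof (rule that[OF p])
    show "p \<in> closure (cspan B)"
      by (rule has_sum_mem_closed_csubspace[OF p csubspace_closure])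
        (auto intro!: complex_vector.subspace_span complex_vector.subspace_scale
          closure_subset[THEN subsetD] complex_vector.span_base complex_vector.span_scale)
    have "cinner (x - p) b = 0" if "b \<in> B" for b
      using orthonormal_on_coeff[OF on p that] by (simp add: cinner_diff_left)
    then show "cinner (x - p) m = 0" if "m \<in> closure (cspan B)" for m
      using that by (rule orthogonal_closure_cspan)
  qed
qed

lemma orthonormal_expansion:
  fixes B :: "'a::chilbert_space set"
  assumes "orthonormal_set B" "x \<in> closure (cspan B)"
  shows "((\<lambda>b. cinner x b *\<^sub>C b) has_sum x) B"
proof -
  obtain p where p: "((\<lambda>b. cinner x b *\<^sub>C b) has_sum p) B" "p \<in> closure (cspan B)"
    "\<And>m. m \<in> closure (cspan B) \<Longrightarrow> cinner (x - p) m = 0"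
    using orthonormal_projection[OF assms(1)] by metis
  have "x - p \<in> closure (cspan B)"
    using assms(2) p(2)
    by (intro complex_vector.subspace_diff csubspace_closure complex_vector.subspace_span)
  from p(3)[OF this] show ?thesis
    using p(1) by simp
qed

text \<open>Zorn's lemma gives a maximal orthonormal subset of \<open>M\<close>; if its closed span
  missed some \<open>x\<close> in \<open>M\<close>, the normalized residual of \<open>x\<close>
  after projection would enlarge it.\<close>

lemma exists_orthonormal_basis:
  fixes M :: "'a::chilbert_space set"
  assumes M: "csubspace M" "closed M"
  shows "\<exists>B. orthonormal_set B \<and> closure (cspan B) = M"
proof -
  define \<A> where "\<A> = {B. B \<subseteq> M \<and> orthonormal_set B}"
  have "\<exists>B\<in>\<A>. \<forall>X\<in>\<A>. B \<subseteq> X \<longrightarrow> X = B"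
  proof (rule subset_Zorn')
    fix C assume C: "subset.chain \<A> C"
    have "cinner x y = (if x = y then 1 else 0)" if "x \<in> \<Union>C" "y \<in> \<Union>C" for x y
    proof -
      obtain X Y where "X \<in> C" "x \<in> X" "Y \<in> C" "y \<in> Y"
        using \<open>x \<in> \<Union>C\<close> \<open>y \<in> \<Union>C\<close> by blast
      moreover have "X \<subseteq> Y \<or> Y \<subseteq> X" "X \<in> \<A>" "Y \<in> \<A>"
        using C \<open>X \<in> C\<close> \<open>Y \<in> C\<close> by (auto simp: subset_chain_def)
      ultimately show ?thesis
        unfolding \<A>_def orthonormal_set_def by blast
    qed
    then show "\<Union>C \<in> \<A>"
      using C by (auto simp: \<A>_def subset_chain_def orthonormal_set_def)
  qed
  then obtain B where "B \<in> \<A>" and B_max: "\<forall>X\<in>\<A>. B \<subseteq> X \<longrightarrow> X = B" ..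
  then have B: "B \<subseteq> M" "orthonormal_set B"
    by (simp_all add: \<A>_def)
  have sub: "closure (cspan B) \<subseteq> M"
    by (intro closure_minimal complex_vector.span_minimal B M)
  moreover have "x \<in> closure (cspan B)" if "x \<in> M" for x
  proof (rule ccontr)
    assume x: "x \<notin> closure (cspan B)"
    obtain p where p: "p \<in> closure (cspan B)" "\<And>m. m \<in> closure (cspan B) \<Longrightarrow> cinner (x - p) m = 0"
      using orthonormal_projection[OF B(2)] by metis
    define r where "r = complex_of_real (1 / norm (x - p)) *\<^sub>C (x - p)"
    have "x - p \<noteq> 0"
      using x p(1) by auto
    then have r1: "cinner r r = 1"
      by (simp add: r_def cinner_self norm_scaleC norm_divide)
    have r0: "cinner r b = 0" if "b \<in> B" for b
      using p(2)[of b] closure_subset[of "cspan B"] complex_vector.span_base[OF that]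
      by (auto simp: r_def cinner_scaleC_left)
    have "r \<in> M"
      unfolding r_def using sub p(1) \<open>x \<in> M\<close> M(1)
      by (intro complex_vector.subspace_scale complex_vector.subspace_diff) auto
    moreover have "orthonormal_set (insert r B)"
      using B(2) r0 r1 cinner_eq_zero_commute[of r] by (auto simp: orthonormal_set_def)
    ultimately have "insert r B \<in> \<A>"
      using B(1) by (simp add: \<A>_def)
    then have "r \<in> B"
      using B_max by blast
    then show False
      using r0 r1 by simp
  qed
  ultimately show ?thesis
    using B(2) by blast
qed

text \<open>Existence of a basis makes the choice in \<open>hdim\<close> meaningful; the basis
  returned is the chosen one, so the dimension can be read off it.\<close>

lemma hdim_orthonormal_basis:
  fixes M :: "'a::chilbert_space set"
  assumes "csubspace M" "closed M"
  obtains B where "orthonormal_set B" "closure (cspan B) = M"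
    "hdim M = (if finite B then enat (card B) else \<infinity>)"
proof -
  define B where "B = (SOME B. orthonormal_set B \<and> closure (cspan B) = M)"
  have "orthonormal_set B \<and> closure (cspan B) = M"
    unfolding B_def by (rule someI_ex[OF exists_orthonormal_basis[OF assms]])
  then show ?thesis
    using that[of B] by (simp add: hdim_def B_def[symmetric] Let_def)
qed

lemma orthogonal_decomposition:
  fixes M :: "'a::chilbert_space set"
  assumes "csubspace M" "closed M"
  obtains p q where "x = p + q" "p \<in> M" "q \<in> ortho_compl M"
proof -
  obtain B where B: "orthonormal_set B" "closure (cspan B) = M"
    using exists_orthonormal_basis[OF assms] by blast
  obtain p where "p \<in> M" "\<And>m. m \<in> M \<Longrightarrow> cinner (x - p) m = 0"
    using orthonormal_projection[OF B(1), of x] B(2) by metis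
  then show ?thesis
    using that[of p "x - p"] by (auto simp: ortho_compl_def)
qed

text \<open>Double counting of the sum of \<open>(cmod (cinner b d))\<^sup>2\<close>: Parseval's
  identity makes each \<open>d\<close> contribute 1, while Bessel's inequality lets each
  \<open>b\<close> contribute at most 1. Arguing with finite subsets of \<open>D\<close> yields its
  finiteness as well.\<close>

lemma card_orthonormal_le:
  fixes B :: "'a::chilbert_space set"
  assumes B: "finite B" "orthonormal_set B"
    and D: "orthonormal_set D" "D \<subseteq> closure (cspan B)"
  shows "finite D \<and> card D \<le> card B"
proof (rule finite_if_finite_subsets_card_bdd)
  fix G assume G: "G \<subseteq> D" "finite G"
  have norm1: "norm x = 1" if "orthonormal_set X" "x \<in> X" for x :: 'a and X
  proof -
    have "(norm x)\<^sup>2 = 1"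
      using that unfolding orthonormal_set_def by (simp flip: Re_cinner_self)
    then show ?thesis
      using norm_ge_zero[of x] by (simp add: power2_eq_1_iff)
  qed
  have parseval: "(\<Sum>b\<in>B. (cmod (cinner d b))\<^sup>2) = 1" if "d \<in> G" for d
  proof -
    have d: "d = (\<Sum>b\<in>B. cinner d b *\<^sub>C b)"
      using has_sum_unique[OF orthonormal_expansion[OF B(2)] has_sum_finite[OF B(1)]] D G that by blast
    have "cinner d d = (\<Sum>b\<in>B. complex_of_real ((cmod (cinner d b))\<^sup>2))"
      by (subst (2) d)
         (simp add: cinner_sum_right cinner_scaleC_right complex_norm_square mult.commute del: of_real_power)
    moreover have "cinner d d = 1"
      using D G that by (auto simp: orthonormal_set_def)
    ultimately show ?thesis
      by (metis of_real_eq_1_iff of_real_sum)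
  qed
  have "bessel G (\<lambda>d. d) 1"
    by (intro orthonormal_on_bessel orthonormal_setD orthonormal_set_subset[OF D(1)] G)
  from bessel_analysis_finite[OF this G(2) order_refl]
  have "(\<Sum>d\<in>G. (cmod (cinner b d))\<^sup>2) \<le> 1" if "b \<in> B" for b
    using norm1[OF B(2) that] by (metis L2_set_def mult.right_neutral mult_1 real_sqrt_le_1_iff)
  then have "(\<Sum>b\<in>B. \<Sum>d\<in>G. (cmod (cinner b d))\<^sup>2) \<le> card B"
    using sum_mono[of B "\<lambda>b. \<Sum>d\<in>G. (cmod (cinner b d))\<^sup>2" "\<lambda>_. 1"] by simp
  moreover have "(\<Sum>b\<in>B. \<Sum>d\<in>G. (cmod (cinner b d))\<^sup>2) = card G"
    by (subst sum.swap) (simp add: cmod_cinner_commute[of _ "_ :: 'a"] parseval)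
  ultimately show "card G \<le> card B"
    by simp
qed

text \<open>Distinct orthonormal vectors have squared distance 2, so points of a countable dense set
  within 1/2 of them are distinct.\<close>

lemma countable_orthonormal_set:
  assumes "separable_space (euclidean :: 'a::chilbert_space topology)" "orthonormal_set (B :: 'a set)"
  shows "countable B"
proof -
  obtain C :: "'a set" where C: "countable C" "closure C = UNIV"
    using assms(1) by (auto simp: separable_space_def euclidean_closure_of)
  have "\<exists>c\<in>C. dist c b < 1/2" for b
    using C(2) closure_approachable[of b C] half_gt_zero[OF zero_less_one] by blast
  then obtain g where g: "\<And>b. g b \<in> C" "\<And>b. dist (g b) b < 1/2"
    by metis
  have "inj_on g B"
  proof (rule inj_onI, rule ccontr)
    fix b b' assume b: "b \<in> B" "b' \<in> B" "g b = g b'" "b \<noteq> b'"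
    then have "(norm (b - b'))\<^sup>2 = 2"
      using assms(2) unfolding norm_diff_square orthonormal_set_def by (simp flip: Re_cinner_self)
    moreover have "dist b b' < 1"
      using dist_triangle3[of b b' "g b"] g(2)[of b] g(2)[of b'] b(3) by simp
    then have "(norm (b - b'))\<^sup>2 < 1"
      by (simp add: dist_norm power_less_one_iff)
    ultimately show False
      by simp
  qed
  then show ?thesis
    using C(1) g(1) by (metis countable_image_inj_on countable_subset image_subsetI)
qed

section \<open>Coordinates, analysis and synthesis on \<open>ell2\<close>\<close>

definition unit_vec :: "'i \<Rightarrow> 'i ell2" where
  "unit_vec i = Abs_ell2 (\<lambda>j. if j = i then 1 else 0)"

lemma coeff_unit_vec: "ell2_coeff (unit_vec i) j = (if j = i then 1 else 0)"
proof -
  have "(\<lambda>j. (cmod (if j = i then 1 else 0))\<^sup>2) summable_on UNIV"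
    by (rule has_sum_imp_summable[OF has_sum_single[of i]]) auto
  then show ?thesis
    unfolding unit_vec_def by (subst Abs_ell2_inverse) auto
qed

lemma cinner_unit_vec: "cinner c (unit_vec i) = ell2_coeff c i"
  using has_sum_single[of i UNIV "\<lambda>j. ell2_coeff c j * cnj (ell2_coeff (unit_vec i) j)"]
  by (auto simp: cinner_ell2_def coeff_unit_vec infsumI)

lemma has_sum_coeff:
  "(g has_sum s) A \<Longrightarrow> ((\<lambda>k. ell2_coeff (g k) i) has_sum ell2_coeff s i) A"
  using has_sum_cinner_left[where y = "unit_vec i"] by (simp add: cinner_unit_vec)

lemma norm_ell2_square: "(norm c)\<^sup>2 = (\<Sum>\<^sub>\<infinity>i. (cmod (ell2_coeff c i))\<^sup>2)"
  by (simp add: norm_ell2_def ell2_norm_def infsum_nonneg)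

text \<open>Total by the junk value of \<open>Abs_ell2\<close>; meaningful for Bessel sequences.\<close>

definition analysis :: "('i \<Rightarrow> 'a::complex_inner) \<Rightarrow> 'a \<Rightarrow> 'i ell2" where
  "analysis v x = Abs_ell2 (\<lambda>i. cinner x (v i))"

lemma coeff_analysis:
  assumes "bessel UNIV v K" shows "ell2_coeff (analysis v x) i = cinner x (v i)"
  unfolding analysis_def using bessel_analysis(1)[OF assms] by (subst Abs_ell2_inverse) auto

lemma synthesis_has_sum:
  assumes "bessel UNIV v K"
  shows "((\<lambda>i. ell2_coeff c i *\<^sub>C v i) has_sum synthesis v c) UNIV"
  unfolding synthesis_def
  by (intro has_sum_infsum bessel_synthesis(1)[OF assms] ell2_coeff_summable)

lemma norm_synthesis_le:
  assumes "bessel UNIV v K" shows "norm (synthesis v c) \<le> K * norm c"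
  using bessel_synthesis(2)[OF assms ell2_coeff_summable, of c]
  by (simp add: synthesis_def norm_ell2_def ell2_norm_def)

text \<open>Synthesis is the adjoint of analysis; the inner product is taken term by term.\<close>

lemma cinner_synthesis:
  assumes "bessel UNIV v K"
  shows "cinner (synthesis v c) x = cinner c (analysis v x)"
proof -
  have "((\<lambda>i. ell2_coeff c i * cinner (v i) x) has_sum cinner (synthesis v c) x) UNIV"
    using has_sum_cinner_left[OF synthesis_has_sum[OF assms]] by (simp add: cinner_scaleC_left)
  moreover have "cinner (v i) x = cnj (cinner x (v i))" for i
    by (rule cinner_commute)
  ultimately show ?thesis
    by (simp add: cinner_ell2_def coeff_analysis[OF assms] infsumI)
qed

text \<open>The kernel of an operator is the orthogonal complement of the range of its adjoint. This
  form also shows that the kernel is a closed subspace.\<close>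

lemma synthesis_ker_eq:
  fixes v :: "'i \<Rightarrow> 'a::chilbert_space"
  assumes "bessel UNIV v K"
  shows "synthesis_ker v = ortho_compl (range (analysis v))"
proof -
  have "c \<in> synthesis_ker v \<longleftrightarrow> synthesis v c = 0" for c
    using synthesis_has_sum[OF assms, of c] by (auto simp: synthesis_ker_def summable_on_def)
  moreover have "s = 0 \<longleftrightarrow> (\<forall>x. cinner s x = 0)" for s :: 'a
    by (metis cinner_self_eq_zero cinner_zero_left)
  ultimately show ?thesis
    by (auto simp: ortho_compl_def cinner_synthesis[OF assms])
qed

lemma norm_analysis_square:
  assumes "bessel UNIV v K"
  shows "(norm (analysis v x))\<^sup>2 = (\<Sum>\<^sub>\<infinity>i. (cmod (cinner x (v i)))\<^sup>2)"
  by (simp add: norm_ell2_square coeff_analysis[OF assms])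

text \<open>The upper bound holds on \<open>M\<close> only, which suffices because the sequence lies
  in \<open>M\<close>; the square root appears since frame bounds concern squared norms.\<close>

lemma frame_bounds_bessel:
  fixes f :: "'i \<Rightarrow> 'a::chilbert_space"
  assumes "frame_bounds M f A B" "csubspace M" "0 \<le> B"
  shows "bessel UNIV f (sqrt B)"
proof (rule bessel_subspaceI[OF assms(2)])
  show "f i \<in> M" for i
    using assms(1) by (auto simp: frame_bounds_def)
  fix x and F :: "'i set" assume x: "x \<in> M" and F: "finite F"
  have "(\<Sum>i\<in>F. (cmod (cinner x (f i)))\<^sup>2) \<le> (\<Sum>\<^sub>\<infinity>i. (cmod (cinner x (f i)))\<^sup>2)"
    using assms(1) x F by (intro finite_sum_le_infsum) (auto simp: frame_bounds_def)
  also have "\<dots> \<le> B * (norm x)\<^sup>2"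
    using assms(1) x by (auto simp: frame_bounds_def)
  finally show "L2_set (\<lambda>i. cmod (cinner x (f i))) F \<le> sqrt B * norm x"
    using assms(3) by (simp add: L2_set_def real_sqrt_mult real_le_lsqrt power_mult_distrib)
qed (use assms(3) in auto)

section \<open>Parseval frames: isometric analysis and reconstruction\<close>

lemma parseval_bessel: "parseval_frame_for M v \<Longrightarrow> csubspace M \<Longrightarrow> bessel UNIV v 1"
  using frame_bounds_bessel[of M v 1 1] by (simp add: parseval_frame_for_def)

lemma parseval_norm_analysis:
  assumes "parseval_frame_for M v" "csubspace M" "x \<in> M"
  shows "norm (analysis v x) = norm x"
proof -
  have "(norm (analysis v x))\<^sup>2 = (norm x)\<^sup>2"
    using assms(1,3) unfolding norm_analysis_square[OF parseval_bessel[OF assms(1,2)]]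
    by (auto simp: parseval_frame_for_def frame_bounds_def intro!: antisym)
  then show ?thesis
    by simp
qed

text \<open>The vector \<open>t\<close>, the synthesis of the analysis of \<open>x\<close>, has
  inner product with \<open>x\<close> equal to the squared norm of \<open>x\<close> and is no longer
  than \<open>x\<close>; expanding the square of \<open>norm (t - x)\<close> then forces
  \<open>t = x\<close>.\<close>

lemma parseval_reconstruction:
  assumes "parseval_frame_for M v" "csubspace M" "x \<in> M"
  shows "((\<lambda>i. cinner x (v i) *\<^sub>C v i) has_sum x) UNIV"
proof -
  note b = parseval_bessel[OF assms(1,2)]
  define t where "t = synthesis v (analysis v x)"
  have n: "norm (analysis v x) = norm x"
    by (rule parseval_norm_analysis[OF assms])
  have "cinner t x = complex_of_real ((norm x)\<^sup>2)"
    by (simp add: t_def cinner_synthesis[OF b] cinner_self n)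
  moreover have "(norm t)\<^sup>2 \<le> (norm x)\<^sup>2"
    using norm_synthesis_le[OF b, of "analysis v x"] by (simp add: t_def n)
  ultimately have "(norm (t - x))\<^sup>2 \<le> 0"
    by (simp add: norm_diff_square)
  then have "t = x"
    by simp
  then show ?thesis
    using synthesis_has_sum[OF b, of "analysis v x"] by (simp add: t_def coeff_analysis[OF b])
qed

text \<open>Moving the second analysis across by adjointness leaves synthesis after analysis, which
  is the identity on \<open>M\<close>.\<close>

lemma parseval_cinner_analysis:
  assumes "parseval_frame_for M v" "csubspace M" "x \<in> M"
  shows "cinner (analysis v x) (analysis v z) = cinner x z"
proof -
  note b = parseval_bessel[OF assms(1,2)]
  have "synthesis v (analysis v x) = x"
    using parseval_reconstruction[OF assms] synthesis_has_sum[OF b, of "analysis v x"]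
    by (simp add: coeff_analysis[OF b] has_sum_unique)
  then show ?thesis
    by (simp flip: cinner_synthesis[OF b])
qed

section \<open>Frame operators, canonical duals and weak R-duals\<close>

lemma cinner_eqI: "(\<And>t. cinner x t = cinner y t) \<Longrightarrow> x = (y :: 'a::complex_inner)"
  by (metis cinner_diff_left cinner_self_eq_zero right_minus_eq)

lemma csubspace_closed_span: "csubspace (closed_span w)"
  unfolding closed_span_def by (intro csubspace_closure complex_vector.subspace_span)

lemma closed_closed_span: "closed (closed_span w)"
  by (simp add: closed_span_def)

lemma mem_closed_span: "w j \<in> closed_span w"
  unfolding closed_span_def by (intro closure_subset[THEN subsetD] complex_vector.span_base) simp

lemma analysis_diff:
  "bessel UNIV v K \<Longrightarrow> analysis v (x - z) = analysis v x - analysis v z"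
  by (rule ell2_eqI) (simp add: coeff_analysis ell2_coeff_simps cinner_diff_left)

lemma frame_op_eq: "bessel UNIV w K \<Longrightarrow> frame_op w x = synthesis w (analysis w x)"
  by (simp add: frame_op_def synthesis_def coeff_analysis)

lemma cinner_frame_op_left:
  "bessel UNIV w K \<Longrightarrow> cinner (frame_op w x) z = cinner (analysis w x) (analysis w z)"
  by (simp add: frame_op_eq cinner_synthesis)

lemma cinner_frame_op_right:
  "bessel UNIV w K \<Longrightarrow> cinner x (frame_op w z) = cinner (analysis w x) (analysis w z)"
  by (metis cinner_commute cinner_frame_op_left)

lemma frame_op_diff:
  "bessel UNIV w K \<Longrightarrow> frame_op w (x - z) = frame_op w x - frame_op w z"
  by (rule cinner_eqI) (simp add: cinner_frame_op_left cinner_diff_left analysis_diff)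

lemma norm_frame_op_le:
  assumes "bessel UNIV w K" shows "norm (frame_op w x) \<le> K\<^sup>2 * norm x"
proof -
  have K: "0 \<le> K"
    by (rule bessel_nonneg[OF assms])
  have "(norm (analysis w x))\<^sup>2 \<le> (K * norm x)\<^sup>2"
    unfolding norm_analysis_square[OF assms] by (rule bessel_analysis(2)[OF assms])
  then have "norm (analysis w x) \<le> K * norm x"
    by (rule power2_le_imp_le) (simp add: K)
  then have "K * norm (analysis w x) \<le> K * (K * norm x)"
    by (rule mult_left_mono[OF _ K])
  then show ?thesis
    using norm_synthesis_le[OF assms, of "analysis w x"]
    by (simp add: frame_op_eq[OF assms] power2_eq_square mult.assoc)
qed

lemma frame_op_mem_closed_span:
  assumes "bessel UNIV w K" shows "frame_op w x \<in> closed_span w"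
  unfolding frame_op_eq[OF assms]
  by (rule has_sum_mem_closed_csubspace[OF synthesis_has_sum[OF assms] csubspace_closed_span closed_closed_span])
     (intro complex_vector.subspace_scale csubspace_closed_span mem_closed_span)

lemma frame_sequence_bounds:
  assumes "frame_sequence w"
  obtains A K where "0 < A" "bessel UNIV w K"
    "\<And>x. x \<in> closed_span w \<Longrightarrow> A * (norm x)\<^sup>2 \<le> (norm (analysis w x))\<^sup>2"
proof -
  obtain A B where AB: "0 < A" "A \<le> B" "frame_bounds (closed_span w) w A B"
    using assms by (auto simp: frame_sequence_def frame_for_def)
  have b: "bessel UNIV w (sqrt B)"
    by (rule frame_bounds_bessel[OF AB(3) csubspace_closed_span]) (use AB in simp)
  show ?thesis
    by (rule that[OF AB(1) b]) (use AB(3) in \<open>auto simp: norm_analysis_square[OF b] frame_bounds_def\<close>)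
qed

lemma frame_sequence_bessel:
  assumes "frame_sequence w" obtains K where "bessel UNIV w K"
  by (rule frame_sequence_bounds[OF assms]) (rule that)

text \<open>The damped iteration \<open>x \<mapsto> x - r *\<^sub>R (S x - z)\<close> is a contraction, since the
  frame operator \<open>S\<close> is bounded and strongly monotone.\<close>

lemma frame_op_bij:
  fixes w :: "'i \<Rightarrow> 'a::chilbert_space"
  assumes "frame_sequence w" "z \<in> closed_span w"
  shows "\<exists>!x. x \<in> closed_span w \<and> frame_op w x = z"
proof -
  obtain A K where A: "0 < A" and b: "bessel UNIV w K"
    and lower: "\<And>x. x \<in> closed_span w \<Longrightarrow> A * (norm x)\<^sup>2 \<le> (norm (analysis w x))\<^sup>2"
    using frame_sequence_bounds[OF assms(1)] by blast
  let ?S = "frame_op w" and ?M = "closed_span w"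
  \<comment> \<open>Adding \<open>A\<close> to the operator bound \<open>K\<^sup>2\<close>
    guarantees \<open>0 < L\<close> and \<open>A \<le> L\<close>, even if \<open>K = 0\<close>. The
    step \<open>r\<close> minimizes \<open>1 - 2 * r * A + r\<^sup>2 * L\<^sup>2\<close>, and
    \<open>c\<^sup>2\<close> is the minimum.\<close>
  define L where "L = K\<^sup>2 + A"
  define r where "r = A / L\<^sup>2"
  have L: "0 < L" "A \<le> L"
    using A by (auto simp: L_def add_nonneg_pos)
  have r: "0 < r"
    using A L by (simp add: r_def)
  define c where "c = sqrt (1 - (A / L)\<^sup>2)"
  have c: "0 \<le> c" "c < 1"
    using A L by (simp_all add: c_def power_le_one)
  define F where "F x = x - complex_of_real r *\<^sub>C (?S x - z)" for x
  have "\<exists>!x. x \<in> ?M \<and> F x = x"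
  proof (rule Banach_fix[OF _ _ c])
    show "complete ?M"
      using complete_eq_closed closed_closed_span by blast
    show "?M \<noteq> {}"
      using assms(2) by blast
    show "F ` ?M \<subseteq> ?M"
      unfolding F_def using assms(2) frame_op_mem_closed_span[OF b]
      by (auto intro!: complex_vector.subspace_diff complex_vector.subspace_scale csubspace_closed_span)
    fix x x' assume "x \<in> ?M" "x' \<in> ?M"
    define d where "d = x - x'"
    have "d \<in> ?M"
      unfolding d_def by (intro complex_vector.subspace_diff csubspace_closed_span \<open>x \<in> ?M\<close> \<open>x' \<in> ?M\<close>)
    have "norm (?S d) \<le> L * norm d"
      using norm_frame_op_le[OF b, of d] mult_right_mono[of "K\<^sup>2" L "norm d"] A by (simp add: L_def)
    then have S2: "(norm (?S d))\<^sup>2 \<le> L\<^sup>2 * (norm d)\<^sup>2"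
      by (metis norm_ge_zero power_mono power_mult_distrib)
    have mono: "A * (norm d)\<^sup>2 \<le> Re (cinner d (?S d))"
      using lower[OF \<open>d \<in> ?M\<close>] by (simp add: cinner_frame_op_right[OF b] Re_cinner_self)
    have "F x - F x' = d - complex_of_real r *\<^sub>C ?S d"
      by (simp add: F_def d_def frame_op_diff[OF b] complex_vector.scale_right_diff_distrib)
    then have "(dist (F x) (F x'))\<^sup>2 = (norm d)\<^sup>2 - 2 * r * Re (cinner d (?S d)) + r\<^sup>2 * (norm (?S d))\<^sup>2"
      using r by (simp add: dist_norm norm_diff_square cinner_scaleC_right norm_scaleC power_mult_distrib)
    also have "\<dots> \<le> (norm d)\<^sup>2 - 2 * r * (A * (norm d)\<^sup>2) + r\<^sup>2 * (L\<^sup>2 * (norm d)\<^sup>2)"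
      using mono S2 r by (intro add_mono diff_mono mult_left_mono) auto
    also have "\<dots> = (1 - (A / L)\<^sup>2) * (norm d)\<^sup>2"
      using L by (simp add: r_def field_simps power2_eq_square)
    also have "\<dots> = (c * norm d)\<^sup>2"
      using A L by (simp add: c_def power_mult_distrib power_le_one)
    finally have "dist (F x) (F x') \<le> c * norm d"
      by (rule power2_le_imp_le) (simp add: c(1))
    then show "dist (F x) (F x') \<le> c * dist x x'"
      by (simp add: d_def dist_norm)
  qed
  moreover have "F x = x \<longleftrightarrow> ?S x = z" for x
    using r by (simp add: F_def)
  ultimately show ?thesis
    by simp
qed

section \<open>Canonical duals of frame sequences\<close>

lemma canonical_dual:
  assumes "frame_sequence w"
  shows "canonical_dual w j \<in> closed_span w" "frame_op w (canonical_dual w j) = w j"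
proof -
  obtain K where b: "bessel UNIV w K"
    by (rule frame_sequence_bessel[OF assms])
  have inj: "inj_on (frame_op w) (closed_span w)"
    using frame_op_bij[OF assms frame_op_mem_closed_span[OF b]] by (metis inj_onI)
  have w: "w j \<in> frame_op w ` closed_span w"
    using frame_op_bij[OF assms mem_closed_span[of w j]] by (metis image_eqI)
  show "canonical_dual w j \<in> closed_span w"
    unfolding canonical_dual_def by (rule the_inv_into_into[OF inj w order_refl])
  show "frame_op w (canonical_dual w j) = w j"
    unfolding canonical_dual_def by (rule f_the_inv_into_f[OF inj w])
qed

text \<open>The frame operator is self-adjoint and sends the dual element to \<open>w k\<close>, so
  the dual coefficients of a vector in its range are the coefficients of a preimage against
  \<open>w\<close>.\<close>

lemma cinner_frame_op_canonical_dual: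
  assumes "frame_sequence w"
  shows "cinner (frame_op w z) (canonical_dual w k) = cinner z (w k)"
proof -
  obtain K where b: "bessel UNIV w K"
    by (rule frame_sequence_bessel[OF assms])
  show ?thesis
    using cinner_frame_op_right[OF b, of z "canonical_dual w k"]
    by (simp add: canonical_dual[OF assms] cinner_frame_op_left[OF b])
qed

text \<open>Write \<open>x = frame_op w z\<close>. The dual coefficients of \<open>x\<close> are the
  coefficients of \<open>z\<close> against \<open>w\<close>, and the lower frame bound gives
  \<open>norm z \<le> norm x / A\<close>.\<close>

lemma canonical_dual_bessel:
  fixes w :: "'i \<Rightarrow> 'a::chilbert_space"
  assumes "frame_sequence w"
  obtains K where "bessel UNIV (canonical_dual w) K"
proof -
  obtain A K where A: "0 < A" and b: "bessel UNIV w K"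
    and lower: "\<And>x. x \<in> closed_span w \<Longrightarrow> A * (norm x)\<^sup>2 \<le> (norm (analysis w x))\<^sup>2"
    using frame_sequence_bounds[OF assms] by blast
  have K: "0 \<le> K"
    by (rule bessel_nonneg[OF b])
  have "bessel UNIV (canonical_dual w) (K / A)"
  proof (rule bessel_subspaceI[OF csubspace_closed_span[of w]])
    fix x and F :: "'i set" assume "x \<in> closed_span w" and F: "finite F"
    then obtain z where z: "z \<in> closed_span w" "frame_op w z = x"
      using frame_op_bij[OF assms] by blast
    have "(norm (analysis w z))\<^sup>2 = Re (cinner x z)"
      by (simp add: z(2)[symmetric] cinner_frame_op_left[OF b] Re_cinner_self)
    also have "\<dots> \<le> norm x * norm z"
      using cauchy_schwarz[of x z] complex_Re_le_cmod[of "cinner x z"] by linarith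
    finally have "(A * norm z) * norm z \<le> norm x * norm z"
      using lower[OF z(1)] by (simp add: power2_eq_square mult.assoc)
    then have "norm z \<le> norm x / A"
      using A by (cases "z = 0") (simp_all add: field_simps)
    then have "K * norm z \<le> K / A * norm x"
      using mult_left_mono[OF _ K] by fastforce
    then show "L2_set (\<lambda>i. cmod (cinner x (canonical_dual w i))) F \<le> K / A * norm x"
      using bessel_analysis_finite[OF b F subset_UNIV, of z]
      by (simp add: z(2)[symmetric] cinner_frame_op_canonical_dual[OF assms])
  qed (use A K canonical_dual(1)[OF assms] in auto)
  then show ?thesis
    by (rule that)
qed

text \<open>\<open>p\<close> is the orthogonal projection of \<open>x\<close> onto the closed span:
  writing \<open>m\<close> as \<open>frame_op w z\<close> turns \<open>cinner p m\<close> into the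
  inner product of the analyses of \<open>x\<close> and \<open>z\<close>, which is
  \<open>cinner x m\<close>.\<close>

lemma canonical_dual_projection:
  assumes w: "frame_sequence w"
    and p: "p = (\<Sum>\<^sub>\<infinity>k. cinner x (w k) *\<^sub>C canonical_dual w k)"
  shows "p \<in> closed_span w" "m \<in> closed_span w \<Longrightarrow> cinner p m = cinner x m"
proof -
  obtain K where b: "bessel UNIV w K"
    by (rule frame_sequence_bessel[OF w])
  obtain K' where b': "bessel UNIV (canonical_dual w) K'"
    using canonical_dual_bessel[OF w] .
  have p': "p = synthesis (canonical_dual w) (analysis w x)"
    by (simp add: p synthesis_def coeff_analysis[OF b])
  show "p \<in> closed_span w"
    unfolding p'
    by (rule has_sum_mem_closed_csubspace[OF synthesis_has_sum[OF b'] csubspace_closed_span closed_closed_span])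
       (intro complex_vector.subspace_scale csubspace_closed_span canonical_dual(1)[OF w])
  assume "m \<in> closed_span w"
  then obtain z where z: "frame_op w z = m"
    using frame_op_bij[OF w] by blast
  have "analysis (canonical_dual w) m = analysis w z"
    by (rule ell2_eqI)
       (simp add: coeff_analysis[OF b] coeff_analysis[OF b'] cinner_frame_op_canonical_dual[OF w] flip: z)
  then show "cinner p m = cinner x m"
    using cinner_frame_op_right[OF b, of x z] by (simp add: p' cinner_synthesis[OF b'] z)
qed

text \<open>Pairing the series for \<open>w j\<close> with \<open>v i\<close> gives a sum that the
  matrix equation evaluates.\<close>

lemma cinner_weak_R_dual:
  assumes "weak_R_dual w f u v"
  shows "cinner (w j) (v i) = cinner (f i) (u j)"
proof -
  have w: "((\<lambda>k. cinner (f k) (u j) *\<^sub>C v k) has_sum w j) UNIV"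
    and fix': "((\<lambda>k. cinner (v k) (v i) * cinner (f k) (u j)) has_sum cinner (f i) (u j)) UNIV"
    using assms by (auto simp: weak_R_dual_def transpose_fixes_def gram_def)
  show ?thesis
    using has_sum_unique[OF has_sum_cinner_left[OF w, of "v i"]] fix'
    by (simp add: cinner_scaleC_left mult.commute)
qed

text \<open>Converse of \<open>cinner_weak_R_dual\<close>: given these inner products, Parseval
  reconstruction of \<open>w j\<close> by \<open>v\<close> is the defining series, and pairing it
  with \<open>v i\<close> is the matrix equation.\<close>

lemma weak_R_dualI:
  fixes v :: "'i \<Rightarrow> 'a::chilbert_space"
  assumes u: "parseval_frame_for UNIV u" and v: "parseval_frame_for UNIV v"
    and f: "bessel UNIV f K"
    and wv: "\<And>i j. cinner (w j) (v i) = cinner (f i) (u j)"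
  shows "weak_R_dual w f u v"
  unfolding weak_R_dual_def
proof (intro conjI allI u v)
  fix j
  show "(\<lambda>i. (cmod (cinner (f i) (u j)))\<^sup>2) summable_on UNIV"
    using bessel_analysis(1)[OF f, of "u j"] by (simp add: cmod_cinner_commute)
  have rec: "((\<lambda>i. cinner (w j) (v i) *\<^sub>C v i) has_sum w j) UNIV" for j
    by (rule parseval_reconstruction[OF v complex_vector.subspace_UNIV UNIV_I])
  then show "((\<lambda>i. cinner (f i) (u j) *\<^sub>C v i) has_sum w j) UNIV"
    by (simp add: wv)
  show "transpose_fixes (gram v v) (gram f u)"
    unfolding transpose_fixes_def gram_def
    using has_sum_cinner_left[OF rec, where y = "v _"] by (simp add: cinner_scaleC_left wv mult.commute)
qed

text \<open>By \<open>cinner_weak_R_dual\<close> the coefficients in \<open>y i\<close> are those of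
  \<open>v i\<close> against \<open>w\<close>, so \<open>canonical_dual_projection\<close>
  identifies \<open>y i\<close> as the projection of \<open>v i\<close>.\<close>

lemma weak_R_dual_projection:
  assumes w: "frame_sequence w" and R: "weak_R_dual w f u v"
    and y: "y = (\<lambda>i. \<Sum>\<^sub>\<infinity>k. cinner (u k) (f i) *\<^sub>C canonical_dual w k)"
  shows "y i \<in> closed_span w" "m \<in> closed_span w \<Longrightarrow> cinner (y i) m = cinner (v i) m"
proof -
  have "cinner (u k) (f i) = cinner (v i) (w k)" for k
    by (metis cinner_weak_R_dual[OF R] cinner_commute)
  then have "y i = (\<Sum>\<^sub>\<infinity>k. cinner (v i) (w k) *\<^sub>C canonical_dual w k)"
    by (simp add: y)
  from canonical_dual_projection[OF w this]
  show "y i \<in> closed_span w" "m \<in> closed_span w \<Longrightarrow> cinner (y i) m = cinner (v i) m"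
    by auto
qed

text \<open>Since each \<open>y i\<close> lies in \<open>M\<close>, the analysis of \<open>x\<close>
  by \<open>y\<close> equals the analysis by \<open>v\<close> of the component of \<open>x\<close>
  in \<open>M\<close>; so \<open>c\<close> is orthogonal to the whole range of
  \<open>analysis y\<close>.\<close>

lemma projection_synthesis_ker:
  assumes M: "csubspace M" "closed M" and v: "bessel UNIV v K"
    and y: "\<And>i. y i \<in> M" "\<And>i m. m \<in> M \<Longrightarrow> cinner (y i) m = cinner (v i) m"
    and c: "\<And>m. m \<in> M \<Longrightarrow> cinner c (analysis v m) = 0"
  shows "c \<in> synthesis_ker y"
proof -
  have my: "cinner m (y i) = cinner m (v i)" if "m \<in> M" for m i
    by (metis y(2)[OF that] cinner_commute)
  have b: "bessel UNIV y K"
    by (rule bessel_subspaceI[OF M(1) y(1) bessel_nonneg[OF v]])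
       (simp add: my bessel_analysis_finite[OF v])
  have "cinner c (analysis y x) = 0" for x
  proof -
    obtain p q where pq: "x = p + q" "p \<in> M" "q \<in> ortho_compl M"
      using orthogonal_decomposition[OF M] .
    have "analysis y x = analysis v p"
      by (rule ell2_eqI)
         (use pq y(1) in \<open>simp add: coeff_analysis[OF b] coeff_analysis[OF v] cinner_add_left my ortho_compl_def\<close>)
    then show ?thesis
      using c pq(2) by simp
  qed
  then show ?thesis
    by (auto simp: synthesis_ker_eq[OF b] ortho_compl_def)
qed

text \<open>The vector \<open>unit_vec i - analysis v (v i)\<close> is orthogonal to the range of
  \<open>analysis v\<close>, hence zero by \<open>ker\<close>. Its coordinates give orthonormality,
  and reconstruction gives completeness.\<close>

lemma parseval_orthonormal_basisI:
  assumes v: "parseval_frame_for UNIV v"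
    and ker: "\<And>c. (\<And>x. cinner c (analysis v x) = 0) \<Longrightarrow> c = 0"
  shows "orthonormal_basis v"
proof -
  note b = parseval_bessel[OF v complex_vector.subspace_UNIV]
  have "unit_vec i - analysis v (v i) = 0" for i
  proof (rule ker)
    fix x
    have "cinner (unit_vec i) (analysis v x) = cinner (v i) x"
      by (metis cinner_commute cinner_unit_vec coeff_analysis[OF b])
    then show "cinner (unit_vec i - analysis v (v i)) (analysis v x) = 0"
      by (simp add: cinner_diff_left parseval_cinner_analysis[OF v])
  qed
  then have "analysis v (v i) = unit_vec i" for i
    by simp
  then have "cinner (v i) (v j) = (if i = j then 1 else 0)" for i j
    by (metis coeff_analysis[OF b] coeff_unit_vec)
  moreover have "x \<in> closed_span v" for x
    by (rule has_sum_mem_closed_csubspace[OF _ csubspace_closed_span closed_closed_span],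
        rule parseval_reconstruction[OF v complex_vector.subspace_UNIV UNIV_I])
       (rule complex_vector.subspace_scale[OF csubspace_closed_span mem_closed_span])
  then have "closure (cspan (range v)) = UNIV"
    by (auto simp: closed_span_def)
  ultimately show ?thesis
    by (simp add: orthonormal_basis_def)
qed

text \<open>For an orthonormal basis every unit vector lies in the range of the analysis operator,
  so a vector orthogonal to the range has all coordinates zero.\<close>

lemma orthonormal_basis_analysis_total:
  assumes v: "orthonormal_basis v" "bessel UNIV v K"
    and c: "\<And>x. cinner c (analysis v x) = 0"
  shows "c = 0"
proof (rule ell2_eqI)
  fix i
  have "analysis v (v i) = unit_vec i"
    using v(1) by (intro ell2_eqI) (simp add: coeff_analysis[OF v(2)] coeff_unit_vec orthonormal_basis_def)
  then show "ell2_coeff c i = ell2_coeff 0 i"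
    by (metis c cinner_unit_vec coeff_zero)
qed

text \<open>With \<open>z i = (\<Sum>\<^sub>\<infinity>b\<in>B. cnj (ell2_coeff (e b) i) *\<^sub>C b)\<close> the analysis operator of \<open>z\<close> maps each
  \<open>b \<in> B\<close> to \<open>e b\<close>. Since the \<open>e b\<close> are orthogonal to the range of the analysis operator of \<open>y\<close>,
  the analysis operator of \<open>y + z\<close> is isometric.\<close>

lemma extend_parseval_frame:
  fixes y :: "'i \<Rightarrow> 'a::chilbert_space"
  assumes M: "csubspace M" "closed M" and y: "parseval_frame_for M y"
    and B: "orthonormal_set B" "closure (cspan B) = ortho_compl M"
    and e: "orthonormal_on B e" "\<And>b. b \<in> B \<Longrightarrow> e b \<in> synthesis_ker y"
  obtains v where "parseval_frame_for UNIV v"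
    "\<And>m i. m \<in> M \<Longrightarrow> cinner m (v i) = cinner m (y i)"
    "\<And>b. b \<in> B \<Longrightarrow> analysis v b = e b"
proof -
  note b = parseval_bessel[OF y M(1)]
  note beB = orthonormal_on_bessel[OF e(1)]
  have yM: "y i \<in> M" for i
    using y by (auto simp: parseval_frame_for_def frame_bounds_def)
  define z where "z i = (\<Sum>\<^sub>\<infinity>b\<in>B. cnj (ell2_coeff (e b) i) *\<^sub>C b)" for i
  have z: "((\<lambda>b. cnj (ell2_coeff (e b) i) *\<^sub>C b) has_sum z i) B" for i
    unfolding z_def
  proof (intro has_sum_infsum bessel_synthesis(1)[OF orthonormal_on_bessel[OF orthonormal_setD[OF B(1)]]])
    \<comment> \<open>Coordinate \<open>i\<close> of \<open>e b\<close> is its inner product with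
      \<open>unit_vec i\<close>, so Bessel's inequality for \<open>e\<close> applies.\<close>
    show "(\<lambda>b. (cmod (cnj (ell2_coeff (e b) i)))\<^sup>2) summable_on B"
      using bessel_analysis(1)[OF beB, of "unit_vec i"]
      by (simp add: cmod_cinner_commute[of "unit_vec i"] cinner_unit_vec)
  qed
  have BM: "b \<in> ortho_compl M" if "b \<in> B" for b
    using closure_subset[THEN subsetD, OF complex_vector.span_base[OF that]] by (simp add: B(2))
  have zM: "z i \<in> ortho_compl M" for i
    by (rule has_sum_mem_closed_csubspace[OF z csubspace_ortho_compl closed_ortho_compl])
       (rule complex_vector.subspace_scale[OF csubspace_ortho_compl BM])
  have bz: "cinner b (z i) = ell2_coeff (e b) i" if "b \<in> B" for b i
    using orthonormal_on_coeff[OF orthonormal_setD[OF B(1)] z that]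
    by (metis cinner_commute complex_cnj_cnj)
  define v where "v i = y i + z i" for i
  have mv: "cinner m (v i) = cinner m (y i)" if "m \<in> M" for m i
    using zM[of i] that cinner_eq_zero_commute[of m "z i"]
    by (simp add: v_def cinner_add_right ortho_compl_def)
  have qv: "cinner q (v i) = cinner q (z i)" if "q \<in> ortho_compl M" for q i
    using yM that by (simp add: v_def cinner_add_right ortho_compl_def)
  \<comment> \<open>The witness is \<open>analysis y p + t\<close>, where \<open>p\<close> is the
    component of \<open>x\<close> in \<open>M\<close> and \<open>t\<close> is the image of the other
    component \<open>q\<close> under the isometry extending \<open>e\<close>.\<close>
  have isometry: "\<exists>c. (\<forall>i. ell2_coeff c i = cinner x (v i)) \<and> norm c = norm x" for x
  proof -
    obtain p q where pq: "x = p + q" "p \<in> M" "q \<in> ortho_compl M"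
      using orthogonal_decomposition[OF M] .
    have q: "((\<lambda>b. cinner q b *\<^sub>C b) has_sum q) B"
      using pq(3) B by (intro orthonormal_expansion) auto
    define t where "t = (\<Sum>\<^sub>\<infinity>b\<in>B. cinner q b *\<^sub>C e b)"
    have t: "((\<lambda>b. cinner q b *\<^sub>C e b) has_sum t) B"
      unfolding t_def
      by (intro has_sum_infsum bessel_synthesis(1)[OF beB]
          bessel_analysis(1)[OF orthonormal_on_bessel[OF orthonormal_setD[OF B(1)]]])
    have "((\<lambda>b. cinner q b * cinner b (z i)) has_sum ell2_coeff t i) B" for i
      using has_sum_coeff[OF t, of i] by (rule has_sum_cong[THEN iffD1, rotated]) (simp add: coeff_scaleC bz)
    moreover have "((\<lambda>b. cinner q b * cinner b (z i)) has_sum cinner q (z i)) B" for i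
      using has_sum_cinner_left[OF q, of "z i"] by (simp add: cinner_scaleC_left)
    ultimately have tz: "ell2_coeff t i = cinner q (z i)" for i
      by (rule has_sum_unique)
    have tb: "cinner (e b) t = cinner b q" if "b \<in> B" for b
      using orthonormal_on_coeff[OF e(1) t that] by (metis cinner_commute)
    have "((\<lambda>b. cinner q b * cinner b q) has_sum cinner t t) B"
      using has_sum_cinner_left[OF t, of t]
      by (rule has_sum_cong[THEN iffD1, rotated]) (simp add: cinner_scaleC_left tb)
    moreover have "((\<lambda>b. cinner q b * cinner b q) has_sum cinner q q) B"
      using has_sum_cinner_left[OF q, of q] by (simp add: cinner_scaleC_left)
    ultimately have tt: "(norm t)\<^sup>2 = (norm q)\<^sup>2"
      by (metis has_sum_unique Re_cinner_self)
    have "t \<in> synthesis_ker y"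
      unfolding synthesis_ker_eq[OF b]
      by (rule has_sum_mem_closed_csubspace[OF t csubspace_ortho_compl closed_ortho_compl],
          rule complex_vector.subspace_scale[OF csubspace_ortho_compl])
         (use e(2) synthesis_ker_eq[OF b] in simp)
    then have orth: "cinner (analysis y p) t = 0"
      using cinner_eq_zero_commute[of t] by (auto simp: synthesis_ker_eq[OF b] ortho_compl_def)
    have "cinner p q = 0"
      using pq cinner_eq_zero_commute[of p] by (auto simp: ortho_compl_def)
    then have "(norm (analysis y p + t))\<^sup>2 = (norm x)\<^sup>2"
      by (simp add: norm_add_square orth tt pq(1) parseval_norm_analysis[OF y M(1) pq(2)])
    then have "norm (analysis y p + t) = norm x"
      by simp
    moreover have "ell2_coeff (analysis y p + t) i = cinner x (v i)" for i
      by (simp add: coeff_add coeff_analysis[OF b] tz pq(1) cinner_add_left mv[OF pq(2)] qv[OF pq(3)])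
    ultimately show ?thesis
      by blast
  qed
  have parseval: "parseval_frame_for UNIV v"
    unfolding parseval_frame_for_def frame_bounds_def
  proof (intro conjI ballI)
    fix x
    obtain c where c: "\<And>i. ell2_coeff c i = cinner x (v i)" "norm c = norm x"
      using isometry[of x] by auto
    show "(\<lambda>i. (cmod (cinner x (v i)))\<^sup>2) summable_on UNIV"
      using ell2_coeff_summable[of c] by (simp add: c(1))
    show "1 * (norm x)\<^sup>2 \<le> (\<Sum>\<^sub>\<infinity>i. (cmod (cinner x (v i)))\<^sup>2)"
      "(\<Sum>\<^sub>\<infinity>i. (cmod (cinner x (v i)))\<^sup>2) \<le> 1 * (norm x)\<^sup>2"
      using norm_ell2_square[of c] by (simp_all add: c)
  qed simp
  show ?thesis
  proof (rule that[OF parseval mv])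
    fix b assume "b \<in> B"
    then show "analysis v b = e b"
      by (intro ell2_eqI)
         (simp add: coeff_analysis[OF parseval_bessel[OF parseval complex_vector.subspace_UNIV]] qv[OF BM] bz)
  qed
qed

section \<open>Comparison of dimensions\<close>

lemma orthonormal_on_subset_compose:
  assumes "orthonormal_set D" "inj_on h B" "h ` B \<subseteq> D"
  shows "orthonormal_on B h"
  using assms unfolding orthonormal_set_def orthonormal_on_def inj_on_def
  by (metis image_subset_iff)

lemma synthesis_ker_closed_csubspace:
  "bessel UNIV v K \<Longrightarrow> csubspace (synthesis_ker v)"
  "bessel UNIV v K \<Longrightarrow> closed (synthesis_ker v)"
  by (simp_all add: synthesis_ker_eq csubspace_ortho_compl closed_ortho_compl)

lemma orthonormal_basis_subset: "closure (cspan B) = M \<Longrightarrow> b \<in> B \<Longrightarrow> b \<in> M"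
  using closure_subset complex_vector.span_base by blast

text \<open>The element \<open>d\<close> is set aside before \<open>A\<close> is embedded; later it
  witnesses that the constructed frame is not an orthonormal basis.\<close>

lemma inj_into_infinite:
  assumes "countable A" "infinite B"
  obtains h d where "inj_on h A" "h ` A \<subseteq> B" "d \<in> B - h ` A"
proof -
  obtain d where d: "d \<in> B"
    using assms(2) by fastforce
  obtain g :: "nat \<Rightarrow> _" where g: "inj g" "range g \<subseteq> B - {d}"
    using infinite_countable_subset[of "B - {d}"] assms(2) by auto
  have "inj_on (g \<circ> to_nat_on A) A"
    using g(1) inj_on_to_nat_on[OF assms(1)] by (meson comp_inj_on inj_on_subset subset_UNIV)
  then show ?thesis
    using that[of "g \<circ> to_nat_on A" d] g(2) d by auto
qed

lemma inj_into_larger: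
  assumes "finite A" "finite B" "card A < card B"
  obtains h d where "inj_on h A" "h ` A \<subseteq> B" "d \<in> B - h ` A"
proof -
  obtain h where h: "inj_on h A" "h ` A \<subseteq> B"
    using card_le_inj[OF assms(1,2)] assms(3) by auto
  have "h ` A \<noteq> B"
    using assms(3) card_image[OF h(1)] by auto
  then show ?thesis
    using that h by blast
qed

text \<open>The analyses of the orthogonal complement, and the sequences orthogonal to the range of
  \<open>analysis v\<close>, are both orthogonal to the analyses of the closed span. They supply the
  two mutually orthogonal parts of the kernel used in the dimension count.\<close>

lemma weak_R_dual_ker:
  fixes w :: "'i \<Rightarrow> 'a::chilbert_space"
  assumes w: "frame_sequence w" and R: "weak_R_dual w f u v"
    and y: "y = (\<lambda>i. \<Sum>\<^sub>\<infinity>k. cinner (u k) (f i) *\<^sub>C canonical_dual w k)"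
  shows "bessel UNIV y 1"
    and "b \<in> ortho_compl (closed_span w) \<Longrightarrow> analysis v b \<in> synthesis_ker y"
    and "(\<And>x. cinner c (analysis v x) = 0) \<Longrightarrow> c \<in> synthesis_ker y"
proof -
  let ?M = "closed_span w"
  have v: "parseval_frame_for UNIV v"
    using R by (simp add: weak_R_dual_def)
  note bv = parseval_bessel[OF v complex_vector.subspace_UNIV]
  note yM = weak_R_dual_projection(1)[OF w R y] and yv = weak_R_dual_projection(2)[OF w R y]
  note ker = projection_synthesis_ker[OF csubspace_closed_span[of w] closed_closed_span bv yM yv]
  show "bessel UNIV y 1"
  proof (rule bessel_subspaceI[OF csubspace_closed_span[of w] yM])
    fix x and F :: "'i set" assume "x \<in> ?M" "finite F"
    then show "L2_set (\<lambda>i. cmod (cinner x (y i))) F \<le> 1 * norm x"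
      using bessel_analysis_finite[OF bv, of F x]
      by (simp add: cmod_cinner_commute[of x] yv)
  qed simp
  show "analysis v b \<in> synthesis_ker y" if "b \<in> ortho_compl ?M"
  proof (rule ker)
    show "cinner (analysis v b) (analysis v m) = 0" if "m \<in> ?M" for m
      using that \<open>b \<in> ortho_compl ?M\<close>
      by (simp add: parseval_cinner_analysis[OF v complex_vector.subspace_UNIV] ortho_compl_def)
  qed
  show "c \<in> synthesis_ker y" if "\<And>x. cinner c (analysis v x) = 0"
    using that by (intro ker) simp
qed

lemma parseval_orthonormal_image:
  assumes "parseval_frame_for UNIV v" "orthonormal_set B"
  shows "orthonormal_on B (analysis v)"
  using assms by (simp add: orthonormal_on_def orthonormal_set_def parseval_cinner_analysis)

text \<open>The analysis operator embeds an orthonormal basis of the complement into the kernel. If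
  \<open>v\<close> is not an orthonormal basis, a unit vector orthogonal to the range of
  \<open>analysis v\<close> can be added, which makes the inequality strict in finite
  dimension.\<close>

lemma weak_R_dual_hdim_le:
  fixes w :: "'i \<Rightarrow> 'a::chilbert_space"
  assumes w: "frame_sequence w" and R: "weak_R_dual w f u v"
    and y: "y = (\<lambda>i. \<Sum>\<^sub>\<infinity>k. cinner (u k) (f i) *\<^sub>C canonical_dual w k)"
  shows "hdim (ortho_compl (closed_span w)) \<le> hdim (synthesis_ker y)"
    and "\<not> orthonormal_basis v \<Longrightarrow> hdim (synthesis_ker y) < \<infinity> \<Longrightarrow>
      hdim (ortho_compl (closed_span w)) < hdim (synthesis_ker y)"
proof -
  let ?N = "ortho_compl (closed_span w)"
  note ker = weak_R_dual_ker[OF w R y]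
  have v: "parseval_frame_for UNIV v"
    using R by (simp add: weak_R_dual_def)
  obtain B where B: "orthonormal_set B" "closure (cspan B) = ?N"
    "hdim ?N = (if finite B then enat (card B) else \<infinity>)"
    using hdim_orthonormal_basis[OF csubspace_ortho_compl closed_ortho_compl] .
  obtain D where D: "orthonormal_set D" "closure (cspan D) = synthesis_ker y"
    "hdim (synthesis_ker y) = (if finite D then enat (card D) else \<infinity>)"
    using hdim_orthonormal_basis[OF synthesis_ker_closed_csubspace[OF ker(1)]] .
  note on = parseval_orthonormal_image[OF v B(1)]
  let ?E = "analysis v ` B"
  have E: "?E \<subseteq> synthesis_ker y"
    using ker(2) orthonormal_basis_subset[OF B(2)] by blast
  have card_E: "card ?E = card B" "finite ?E \<longleftrightarrow> finite B"
    using orthonormal_on_inj[OF on] by (simp_all add: card_image finite_image_iff)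
  have "finite B \<and> card B \<le> card D" if "finite D"
    using card_orthonormal_le[OF that D(1) orthonormal_set_image[OF on]] E card_E by (simp add: D(2))
  then show "hdim ?N \<le> hdim (synthesis_ker y)"
    by (simp add: B(3) D(3))
  assume nonb: "\<not> orthonormal_basis v" and "hdim (synthesis_ker y) < \<infinity>"
  then have fD: "finite D"
    by (auto simp: D(3) split: if_splits)
  obtain c where c: "\<And>x. cinner c (analysis v x) = 0" "c \<noteq> 0"
    using parseval_orthonormal_basisI[OF v] nonb by blast
  define d where "d = complex_of_real (1 / norm c) *\<^sub>C c"
  have d0: "cinner d (analysis v x) = 0" for x
    by (simp add: d_def cinner_scaleC_left c(1))
  have d1: "cinner d d = 1"
    using c(2) by (simp add: d_def cinner_self norm_scaleC norm_divide)
  have "orthonormal_set (insert d ?E)"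
    using orthonormal_set_image[OF on] d0 d1 cinner_eq_zero_commute[of d] by (auto simp: orthonormal_set_def)
  moreover have "insert d ?E \<subseteq> closure (cspan D)"
    using E ker(3)[OF d0] by (simp add: D(2))
  ultimately have "finite (insert d ?E) \<and> card (insert d ?E) \<le> card D"
    by (rule card_orthonormal_le[OF fD D(1)])
  moreover have "d \<notin> ?E"
    using d0 d1 by auto
  ultimately have "finite ?E" "card ?E < card D"
    by auto
  then have "finite B" "card B < card D"
    using card_E by simp_all
  then show "hdim ?N < hdim (synthesis_ker y)"
    by (simp add: B(3) D(3) fD)
qed

text \<open>The freedom lies in \<open>e\<close>: the vectors of \<open>synthesis_ker y\<close>
  orthogonal to all \<open>e b\<close> are exactly those orthogonal to the range of
  \<open>analysis v\<close>, so \<open>v\<close> is an orthonormal basis precisely when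
  \<open>e\<close> is total in the kernel. Condition (C) supplies the inner products required by
  \<open>weak_R_dualI\<close>.\<close>

lemma weak_R_dual_construction:
  fixes w f u y :: "'i \<Rightarrow> 'a::chilbert_space"
  assumes w: "frame_sequence w" and f: "frame_for UNIV f" and u: "parseval_frame_for UNIV u"
    and y: "y = (\<lambda>i. \<Sum>\<^sub>\<infinity>k. cinner (u k) (f i) *\<^sub>C canonical_dual w k)"
    and yP: "parseval_frame_for (closed_span w) y"
    and C: "transpose_fixes (gram (canonical_dual w) w) (gram u f)"
    and B: "orthonormal_set B" "closure (cspan B) = ortho_compl (closed_span w)"
    and e: "orthonormal_on B e" "\<And>b. b \<in> B \<Longrightarrow> e b \<in> synthesis_ker y"
  obtains v where "weak_R_dual w f u v"
    "orthonormal_basis v \<longleftrightarrow> (\<forall>c\<in>synthesis_ker y. (\<forall>b\<in>B. cinner c (e b) = 0) \<longrightarrow> c = 0)"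
proof -
  let ?M = "closed_span w"
  note M = csubspace_closed_span[of w] closed_closed_span[of w]
  obtain v where v: "parseval_frame_for UNIV v"
    and mv: "\<And>m i. m \<in> ?M \<Longrightarrow> cinner m (v i) = cinner m (y i)"
    and bv: "\<And>b. b \<in> B \<Longrightarrow> analysis v b = e b"
    using extend_parseval_frame[OF M yP B e] by blast
  note besv = parseval_bessel[OF v complex_vector.subspace_UNIV] and besy = parseval_bessel[OF yP M(1)]
  obtain K where besf: "bessel UNIV f K"
    using f frame_bounds_bessel[of UNIV f] by (fastforce simp: frame_for_def)
  obtain K' where besd: "bessel UNIV (canonical_dual w) K'"
    using canonical_dual_bessel[OF w] .
  \<comment> \<open>The series for \<open>y i\<close> paired with \<open>w j\<close> is the left
    side of (C).\<close>
  have "cinner (y i) (w j) = cinner (u j) (f i)" for i j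
  proof -
    have "(\<lambda>k. (cmod (cinner (u k) (f i)))\<^sup>2) summable_on UNIV"
      using bessel_analysis(1)[OF parseval_bessel[OF u complex_vector.subspace_UNIV], of "f i"]
      by (simp add: cmod_cinner_commute)
    then have "((\<lambda>k. cinner (u k) (f i) *\<^sub>C canonical_dual w k) has_sum y i) UNIV"
      unfolding y by (intro has_sum_infsum bessel_synthesis(1)[OF besd])
    then have "((\<lambda>k. cinner (canonical_dual w k) (w j) * cinner (u k) (f i)) has_sum cinner (y i) (w j)) UNIV"
      using has_sum_cinner_left[where y = "w j"] by (fastforce simp: cinner_scaleC_left mult.commute)
    then show ?thesis
      using C by (auto simp: transpose_fixes_def gram_def intro: has_sum_unique)
  qed
  then have wv: "cinner (w j) (v i) = cinner (f i) (u j)" for i j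
    unfolding mv[OF mem_closed_span] by (metis cinner_commute)
  have R: "weak_R_dual w f u v"
    by (rule weak_R_dualI[OF u v besf wv])
  \<comment> \<open>On the component of \<open>x\<close> in the closed span, \<open>v\<close> and
    \<open>y\<close> have the same analysis; on the complement it suffices to test the basis
    \<open>B\<close>, whose analyses are the \<open>e b\<close>.\<close>
  have orth: "cinner c (analysis v x) = 0"
    if c: "c \<in> synthesis_ker y" "\<And>b. b \<in> B \<Longrightarrow> cinner c (e b) = 0" for c x
  proof -
    have s: "cinner (synthesis v c) x = cinner c (analysis v x)" for x
      by (rule cinner_synthesis[OF besv])
    obtain p q where pq: "x = p + q" "p \<in> ?M" "q \<in> ortho_compl ?M"
      using orthogonal_decomposition[OF M] .
    have "analysis v p = analysis y p"
      by (rule ell2_eqI) (simp add: coeff_analysis[OF besv] coeff_analysis[OF besy] mv[OF pq(2)])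
    then have "cinner (synthesis v c) p = 0"
      using c(1) by (auto simp: s synthesis_ker_eq[OF besy] ortho_compl_def)
    moreover have "cinner (synthesis v c) q = 0"
    proof (rule orthogonal_closure_cspan)
      show "q \<in> closure (cspan B)"
        by (simp add: pq(3) B(2))
    qed (simp add: s bv c(2))
    ultimately show ?thesis
      by (simp add: s[symmetric] pq(1) cinner_add_right)
  qed
  have "orthonormal_basis v \<longleftrightarrow> (\<forall>c\<in>synthesis_ker y. (\<forall>b\<in>B. cinner c (e b) = 0) \<longrightarrow> c = 0)"
  proof
    assume onb: "orthonormal_basis v"
    show "\<forall>c\<in>synthesis_ker y. (\<forall>b\<in>B. cinner c (e b) = 0) \<longrightarrow> c = 0"
    proof (intro ballI impI)
      fix c assume "c \<in> synthesis_ker y" "\<forall>b\<in>B. cinner c (e b) = 0"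
      then show "c = 0"
        by (intro orthonormal_basis_analysis_total[OF onb besv] orth) auto
    qed
  next
    assume total: "\<forall>c\<in>synthesis_ker y. (\<forall>b\<in>B. cinner c (e b) = 0) \<longrightarrow> c = 0"
    show "orthonormal_basis v"
    proof (rule parseval_orthonormal_basisI[OF v])
      fix c assume c: "\<And>x. cinner c (analysis v x) = 0"
      then have "c \<in> synthesis_ker y"
        by (rule weak_R_dual_ker(3)[OF w R y])
      moreover have "\<forall>b\<in>B. cinner c (e b) = 0"
        using c bv by metis
      ultimately show "c = 0"
        using total by blast
    qed
  qed
  then show ?thesis
    by (rule that[OF R])
qed

theorem theorem2p7:
  fixes w f u y :: "'i::countable \<Rightarrow> 'h::chilbert_space"
  assumes "separable_space (euclidean :: 'h topology)"
    and "hdim (UNIV :: 'h set) = \<infinity>"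
    and "frame_sequence w"
    and "frame_for UNIV f"
    and "parseval_frame_for UNIV u"
    and "y = (\<lambda>i. \<Sum>\<^sub>\<infinity>k. cinner (u k) (f i) *\<^sub>C canonical_dual w k)"
  shows "(parseval_frame_for (closed_span w) y \<and>
           transpose_fixes (gram (canonical_dual w) w) (gram u f) \<and>
           (hdim (ortho_compl (cspan (range w))) < hdim (synthesis_ker y) \<or>
            (hdim (ortho_compl (cspan (range w))) = \<infinity> \<and> hdim (synthesis_ker y) = \<infinity>))
           \<longrightarrow> (\<exists>v. parseval_frame_for UNIV v \<and> \<not> orthonormal_basis v \<and> weak_R_dual w f u v)) \<and>
         (parseval_frame_for (closed_span w) y \<and>
           transpose_fixes (gram (canonical_dual w) w) (gram u f) \<and>
           hdim (ortho_compl (cspan (range w))) = hdim (synthesis_ker y) \<and>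
           hdim (synthesis_ker y) < \<infinity>
           \<longrightarrow> (\<exists>v. orthonormal_basis v \<and> weak_R_dual w f u v) \<and>
               \<not> (\<exists>v'. parseval_frame_for UNIV v' \<and> \<not> orthonormal_basis v' \<and> weak_R_dual w f u v')) \<and>
         (hdim (ortho_compl (cspan (range w))) > hdim (synthesis_ker y)
           \<longrightarrow> \<not> (\<exists>v. parseval_frame_for UNIV v \<and> weak_R_dual w f u v))"
proof -
  let ?M = "closed_span w" and ?K = "synthesis_ker y"
  have perp: "ortho_compl (cspan (range w)) = ortho_compl ?M"
    by (simp add: ortho_compl_cspan closed_span_def)
  obtain B where B: "orthonormal_set B" "closure (cspan B) = ortho_compl ?M"
    "hdim (ortho_compl ?M) = (if finite B then enat (card B) else \<infinity>)"
    using hdim_orthonormal_basis[OF csubspace_ortho_compl closed_ortho_compl] .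
  note construct = weak_R_dual_construction[OF assms(3-6) _ _ B(1,2)]
  note hdim_le = weak_R_dual_hdim_le[OF assms(3) _ assms(6)]
  have basis_K: "\<exists>D. orthonormal_set D \<and> closure (cspan D) = ?K \<and>
      hdim ?K = (if finite D then enat (card D) else \<infinity>)" if "parseval_frame_for ?M y"
    using hdim_orthonormal_basis
      synthesis_ker_closed_csubspace[OF parseval_bessel[OF that csubspace_closed_span]] by metis
  have i: "\<exists>v. parseval_frame_for UNIV v \<and> \<not> orthonormal_basis v \<and> weak_R_dual w f u v"
    if yP: "parseval_frame_for ?M y" and C: "transpose_fixes (gram (canonical_dual w) w) (gram u f)"
      and dim: "hdim (ortho_compl ?M) < hdim ?K \<or> (hdim (ortho_compl ?M) = \<infinity> \<and> hdim ?K = \<infinity>)"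
  proof -
    obtain D where D: "orthonormal_set D" "closure (cspan D) = ?K"
      "hdim ?K = (if finite D then enat (card D) else \<infinity>)"
      using basis_K[OF yP] by blast
    \<comment> \<open>The embedding leaves out some \<open>d\<close>, which lies in the kernel
      orthogonally to every \<open>h b\<close> and so rules out an orthonormal basis.\<close>
    obtain h d where h: "inj_on h B" "h ` B \<subseteq> D" "d \<in> D - h ` B"
    proof (cases "finite D")
      case True
      \<comment> \<open>A finite \<open>D\<close> excludes the second alternative in
        \<open>dim\<close>.\<close>
      then have "finite B" "card B < card D"
        using dim by (auto simp: B(3) D(3) split: if_splits)
      then show ?thesis
        using inj_into_larger[OF _ True] that by blast
    next
      case False
      \<comment> \<open>Separability makes \<open>B\<close> countable, so one argument covers both
        alternatives when the kernel is infinite dimensional.\<close>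
      then show ?thesis
        using inj_into_infinite[OF countable_orthonormal_set[OF assms(1) B(1)]] that by blast
    qed
    have hK: "h b \<in> ?K" if "b \<in> B" for b
      using h(2) that orthonormal_basis_subset[OF D(2)] by blast
    obtain v where v: "weak_R_dual w f u v"
      "orthonormal_basis v \<longleftrightarrow> (\<forall>c\<in>?K. (\<forall>b\<in>B. cinner c (h b) = 0) \<longrightarrow> c = 0)"
      using construct[OF yP C orthonormal_on_subset_compose[OF D(1) h(1,2)] hK] .
    have "cinner d (h b) = 0" if "b \<in> B" for b
    proof -
      have "h b \<in> D" "d \<in> D" "d \<noteq> h b"
        using h that by auto
      then show ?thesis
        using D(1) by (simp add: orthonormal_set_def)
    qed
    moreover have "d \<in> ?K" "d \<noteq> 0"
      using D(1) h(3) orthonormal_basis_subset[OF D(2)] unfolding orthonormal_set_def by force+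
    ultimately have "\<not> orthonormal_basis v"
      using v(2) by blast
    then show ?thesis
      using v(1) by (auto simp: weak_R_dual_def)
  qed
  have ii: "\<exists>v. orthonormal_basis v \<and> weak_R_dual w f u v"
    if yP: "parseval_frame_for ?M y" and C: "transpose_fixes (gram (canonical_dual w) w) (gram u f)"
      and dim: "hdim (ortho_compl ?M) = hdim ?K" "hdim ?K < \<infinity>"
  proof -
    obtain D where D: "orthonormal_set D" "closure (cspan D) = ?K"
      "hdim ?K = (if finite D then enat (card D) else \<infinity>)"
      using basis_K[OF yP] by blast
    have "finite B" "finite D" "card B = card D"
      using dim by (auto simp: B(3) D(3) split: if_splits)
    \<comment> \<open>A bijection leaves no kernel direction uncovered, which forces
      \<open>v\<close> to be an orthonormal basis.\<close>
    then obtain h where "bij_betw h B D"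
      using finite_same_card_bij by blast
    then have h: "inj_on h B" "h ` B = D"
      by (auto simp: bij_betw_def)
    have hK: "h b \<in> ?K" if "b \<in> B" for b
      using h(2) that orthonormal_basis_subset[OF D(2)] by blast
    obtain v where v: "weak_R_dual w f u v"
      "orthonormal_basis v \<longleftrightarrow> (\<forall>c\<in>?K. (\<forall>b\<in>B. cinner c (h b) = 0) \<longrightarrow> c = 0)"
      using construct[OF yP C orthonormal_on_subset_compose[OF D(1) h(1) equalityD1[OF h(2)]] hK] .
    \<comment> \<open>\<open>c\<close> lies in the closed span of \<open>D\<close> and is orthogonal
      to \<open>D\<close>, hence to itself.\<close>
    have "c = 0" if "c \<in> ?K" "\<forall>b\<in>B. cinner c (h b) = 0" for c
      using orthogonal_closure_cspan[of D c c] that h(2) D(2) by auto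
    then have "orthonormal_basis v"
      by (simp add: v(2))
    then show ?thesis
      using v(1) by (intro exI conjI)
  qed
  have ii': "\<not> (\<exists>v. parseval_frame_for UNIV v \<and> \<not> orthonormal_basis v \<and> weak_R_dual w f u v)"
    if dim: "hdim (ortho_compl ?M) = hdim ?K" "hdim ?K < \<infinity>"
  proof
    assume "\<exists>v. parseval_frame_for UNIV v \<and> \<not> orthonormal_basis v \<and> weak_R_dual w f u v"
    then obtain v where "\<not> orthonormal_basis v" "weak_R_dual w f u v"
      by blast
    from hdim_le(2)[OF this(2,1) dim(2)] show False
      by (simp add: dim(1))
  qed
  have iii: "\<not> (\<exists>v. parseval_frame_for UNIV v \<and> weak_R_dual w f u v)"
    if "hdim ?K < hdim (ortho_compl ?M)"
  proof
    assume "\<exists>v. parseval_frame_for UNIV v \<and> weak_R_dual w f u v"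
    then obtain v where "weak_R_dual w f u v"
      by blast
    from hdim_le(1)[OF this] that show False
      by simp
  qed
  show ?thesis
    unfolding perp
    by (intro conjI impI; (elim conjE)?; (rule i ii ii' iii; assumption))
qed

end
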